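(* Let $d\in\mathbb{N}$ and let $G\subset\mathbb{R}^d$ be a convex symmetric body in the isotropic position with isotropic constant $L=L(G)$. Let $m^G(\xi)=\int_G e^{2\pi i\langle x,\xi\rangle}\,{\rm d}x$ for $\xi\in\mathbb{R}^d$. Then for every $\xi\in\mathbb{R}^d\setminus\{0\}$, $$|m^G(\xi)|\le 150\,(L|\xi|)^{-1},\qquad |m^G(\xi)-1|\le 150\,L|\xi|,$$ and $$|\langle \xi,\nabla m^G(\xi)\rangle|\le 150.$$
   Context: A convex symmetric body in $\mathbb{R}^d$ is a bounded, closed, convex set with non-empty interior such that $G=-G$. $G$ is in the isotropic position if $|G|=1$ and there is $L=L(G)>0$ (the isotropic constant) with $\int_G\langle x,\xi\rangle^2\,{\rm d}x=L^2|\xi|^2$ for all $\xi\in\mathbb{R}^d$. $|\xi|$ is the Euclidean norm. *)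

theory Defs
  imports "HOL-Analysis.Analysis"
begin

definition convex_symmetric_body :: "'a::euclidean_space set \<Rightarrow> bool" where
  "convex_symmetric_body G \<longleftrightarrow>
     bounded G \<and> closed G \<and> convex G \<and> interior G \<noteq> {} \<and> uminus ` G = G"

definition isotropic_with_constant :: "'a::euclidean_space set \<Rightarrow> real \<Rightarrow> bool" where
  "isotropic_with_constant G L \<longleftrightarrow>
     measure lebesgue G = 1 \<and> L > 0 \<and>
     (\<forall>\<xi>. integral G (\<lambda>x. (x \<bullet> \<xi>)\<^sup>2) = L\<^sup>2 * (norm \<xi>)\<^sup>2)"

definition isotropic_position :: "'a::euclidean_space set \<Rightarrow> bool" where
  "isotropic_position G \<longleftrightarrow> (\<exists>L. isotropic_with_constant G L)"

definition isotropic_constant :: "'a::euclidean_space set \<Rightarrow> real" where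
  "isotropic_constant G = (THE L. isotropic_with_constant G L)"

definition mG :: "'a::euclidean_space set \<Rightarrow> 'a \<Rightarrow> complex" where
  "mG G \<xi> = integral G (\<lambda>x. exp (2 * complex_of_real pi * \<i> * complex_of_real (x \<bullet> \<xi>)))"

end

(* Let u = x . xi for x uniform in G. Brunn-Minkowski, in the multiplicative midpoint form obtained
   from the Prekopa-Leindler inequality, says that the law of u is log-concave on slabs; with the
   symmetry of G this makes the masses of the consecutive cells [k d, (k+1) d) decrease, and it makes
   the tails decay geometrically, so that an isotropic second moment forces the mass of the first cell
   to be at most d / (L |xi|). Abel summation over the cells, followed by d -> 0, then bounds the
   expectation of an even f(u) by bounds on a primitive of f: sin(2 pi t) / (2 pi) for m, and
   sin(2 pi t) / (2 pi) - t cos(2 pi t), which is at most 2 t, for the radial derivative. No density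
   of u is ever needed. The bound on m - 1 is just the second moment. *)
theory Submission
  imports Defs "HOL-Probability.Probability"
begin

subsection \<open>The Prekopa-Leindler inequality\<close>

text \<open>Brunn-Minkowski concerns sets, but induction on the dimension has to run through
  functions: integrating one coordinate out of an indicator leaves a function. The midpoint form
  f(x) g(y) \<le> h((x+y)/2)^2 carries no exponent depending on the dimension; this is why it passes
  to marginals unchanged and why the constants do not depend on d. The third set or function is
  always given, not built as a Minkowski sum or a supremum whose measurability would have to be
  settled. On the line the obstacle is division: a log-concave sequence with an internal zero has no
  useful ratios. Positivity of the first cell and strict decay of the tails exclude such zeros. Both
  oscillatory integrals obey one criterion: if a primitive F of f satisfies |F x - F 0| \<le>
  \<alpha> + \<beta> x for x \<ge> 0, the expectation of f(u) is at most 2 \<alpha> / (L |\<xi>|) +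
  \<beta> in absolute value. Here \<alpha> is charged to the peak of the law and \<beta> to its
  total mass; \<alpha> = 1/(2 pi), \<beta> = 0 gives decay, and \<alpha> = 0, \<beta> = 2 gives a
  bound free of L.\<close>

lemma cofinal_incseq:
  fixes A :: "real set"
  assumes "A \<noteq> {}"
  obtains s :: "nat \<Rightarrow> real"
  where "incseq s" "\<And>n. \<exists>a\<in>A. s n \<le> a" "\<And>x. x \<in> A \<Longrightarrow> \<exists>n. x \<le> s n"
\<comment> \<open>Every \<open>s n\<close> must lie below some point of \<open>A\<close>, so the
  supremum itself may be used only when it is attained.\<close>
proof (cases "\<exists>m\<in>A. \<forall>x\<in>A. x \<le> m")
  case True
  then obtain m where m: "m \<in> A" "\<And>x. x \<in> A \<Longrightarrow> x \<le> m" by blast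
  show ?thesis
    by (rule that[of "\<lambda>_. m"]) (use m in \<open>auto simp: incseq_def\<close>)
next
  case no_max: False
  show ?thesis
  proof (cases "bdd_above A")
    case True
    have lt: "x < Sup A" if "x \<in> A" for x
    proof -
      have "\<exists>y\<in>A. \<not> y \<le> x" using no_max that by blast
      then obtain y where "y \<in> A" "x < y" by (auto simp: not_le)
      then show ?thesis using cSup_upper[OF _ True, of y] by linarith
    qed
    show ?thesis
    proof (rule that[of "\<lambda>n. Sup A - 1 / real (Suc n)"])
      show "incseq (\<lambda>n. Sup A - 1 / real (Suc n))"
        by (auto simp: incseq_def intro!: divide_left_mono)
      fix n
      have "Sup A - 1 / real (Suc n) < Sup A" by simp
      then obtain a where "a \<in> A" "Sup A - 1 / real (Suc n) < a"
        using less_cSup_iff[OF assms True] by blast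
      then show "\<exists>a\<in>A. Sup A - 1 / real (Suc n) \<le> a" by (auto intro: less_imp_le)
    next
      fix x assume "x \<in> A"
      then have "0 < Sup A - x" using lt by simp
      then obtain n where "inverse (real (Suc n)) < Sup A - x" using reals_Archimedean by blast
      then show "\<exists>n. x \<le> Sup A - 1 / real (Suc n)" by (auto simp: inverse_eq_divide intro!: exI[of _ n])
    qed
  next
    case False
    show ?thesis
    proof (rule that[of real])
      show "incseq real" by (auto simp: incseq_def)
      show "\<exists>a\<in>A. real n \<le> a" for n
        using False unfolding bdd_above_def by (meson le_cases)
      show "\<exists>n. x \<le> real n" for x by (rule real_arch_simple)
    qed
  qed
qed

text \<open>Continuity from below along a sequence cofinal in \<open>A\<close>. The cuts are made at
  points of \<open>A\<close> because \<open>brunn_minkowski_real\<close> averages with the cut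
  point, which must therefore be an element.\<close>

lemma emeasure_add_le_of_initial_parts:
  fixes A :: "real set" and c d :: ennreal
  assumes [measurable]: "A \<in> sets borel" and "A \<noteq> {}"
    and le: "\<And>a. a \<in> A \<Longrightarrow> emeasure lborel (A \<inter> {..a}) + d \<le> c"
  shows "emeasure lborel A + d \<le> c"
proof -
  obtain s :: "nat \<Rightarrow> real" where s: "incseq s" "\<And>n. \<exists>a\<in>A. s n \<le> a"
      "\<And>x. x \<in> A \<Longrightarrow> \<exists>n. x \<le> s n"
    using cofinal_incseq[OF \<open>A \<noteq> {}\<close>] by blast
  have "(\<Union>n. A \<inter> {..s n}) = A" using s(3) by auto
  moreover have "(SUP n. emeasure lborel (A \<inter> {..s n})) = emeasure lborel (\<Union>n. A \<inter> {..s n})"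
    using s(1) by (intro SUP_emeasure_incseq) (auto simp: incseq_def intro: order_trans)
  ultimately have "emeasure lborel A + d = (SUP n. emeasure lborel (A \<inter> {..s n}) + d)"
    by (simp add: ennreal_SUP_add_left)
  also have "\<dots> \<le> c"
  proof (rule SUP_least)
    fix n
    obtain a where a: "a \<in> A" "s n \<le> a" using s(2) by blast
    have "emeasure lborel (A \<inter> {..s n}) \<le> emeasure lborel (A \<inter> {..a})"
      using a by (intro emeasure_mono) auto
    then show "emeasure lborel (A \<inter> {..s n}) + d \<le> c"
      using le[OF a(1)] by (meson add_right_mono order_trans)
  qed
  finally show ?thesis .
qed

lemma emeasure_lborel_vimage_uminus:
  fixes A :: "real set"
  assumes [measurable]: "A \<in> sets borel"
  shows "emeasure lborel ((\<lambda>x. - x) -` A) = emeasure lborel A"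
  by (subst (2) lborel_distr_uminus[symmetric]) (simp add: emeasure_distr)

lemma emeasure_lborel_vimage_midpoint:
  fixes A :: "real set"
  assumes [measurable]: "A \<in> sets borel"
  shows "2 * emeasure lborel ((\<lambda>x. 2 * x - b) -` A) = emeasure lborel A"
proof -
  have "emeasure lborel A
      = emeasure (density (distr lborel borel (\<lambda>x. - b + 2 * x)) (\<lambda>_. 2)) A"
    using lborel_real_affine[of 2 "-b"] by simp
  also have "\<dots> = 2 * emeasure lborel ((\<lambda>x. - b + 2 * x) -` A)"
    by (simp add: emeasure_density nn_integral_cmult emeasure_distr)
  finally show ?thesis by (simp add: algebra_simps)
qed

text \<open>Average the part of \<open>A\<close> up to \<open>a\<close> with the fixed point
  \<open>b\<close>, and the part of \<open>B\<close> from \<open>b\<close> on with the fixed point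
  \<open>a\<close>. The two half-size copies lie in \<open>C\<close> on opposite sides of (a + b) /
  2, so their measures add; then \<open>a\<close> and \<open>b\<close> move to the upper end of
  \<open>A\<close> and the lower end of \<open>B\<close>.\<close>

lemma brunn_minkowski_real:
  fixes A B C :: "real set"
  assumes [measurable]: "A \<in> sets borel" "B \<in> sets borel" "C \<in> sets borel"
    and ne: "A \<noteq> {}" "B \<noteq> {}"
    and mid: "\<And>x y. x \<in> A \<Longrightarrow> y \<in> B \<Longrightarrow> (x + y) / 2 \<in> C"
  shows "emeasure lborel A + emeasure lborel B \<le> 2 * emeasure lborel C"
proof -
  have key: "emeasure lborel (A \<inter> {..a}) + emeasure lborel (B \<inter> {b..}) \<le> 2 * emeasure lborel C"
    if ab: "a \<in> A" "b \<in> B" for a b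
  proof -
    define P where "P = (\<lambda>x. 2 * x - b) -` (A \<inter> {..a})"
    \<comment> \<open>The strict \<open>b<..\<close> keeps \<open>Q\<close> off the point (a + b) /
      2, which belongs to \<open>P\<close>. The lost point is null.\<close>
    define Q where "Q = (\<lambda>x. 2 * x - a) -` (B \<inter> {b<..})"
    have [measurable]: "P \<in> sets borel" "Q \<in> sets borel"
      unfolding P_def Q_def by (auto intro!: measurable_sets_borel[where A=borel])
    have sub: "P \<union> Q \<subseteq> C"
    proof
      fix x assume "x \<in> P \<union> Q"
      then show "x \<in> C"
        using mid[of "2 * x - b" b] mid[of a "2 * x - a"] ab by (auto simp: P_def Q_def)
    qed
    have "emeasure lborel (B \<inter> {b..}) = emeasure lborel (B \<inter> {b<..})"
    proof (rule emeasure_eq_AE)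
      show "AE x in lborel. (x \<in> B \<inter> {b..}) = (x \<in> B \<inter> {b<..})"
        using AE_lborel_singleton[of b] by eventually_elim auto
    qed auto
    then have "emeasure lborel (A \<inter> {..a}) + emeasure lborel (B \<inter> {b..})
        = 2 * emeasure lborel P + 2 * emeasure lborel Q"
      by (simp add: P_def Q_def emeasure_lborel_vimage_midpoint del: vimage_Int)
    also have "\<dots> = 2 * emeasure lborel (P \<union> Q)"
      by (subst plus_emeasure[symmetric]) (auto simp: P_def Q_def distrib_left)
    also have "\<dots> \<le> 2 * emeasure lborel C"
      using sub by (intro mult_left_mono emeasure_mono) auto
    finally show ?thesis .
  qed
  have "emeasure lborel B + emeasure lborel (A \<inter> {..a}) \<le> 2 * emeasure lborel C" if "a \<in> A" for a
  proof -
    \<comment> \<open>Reflection turns final parts of \<open>B\<close> into initial parts, so the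
      same exhaustion serves for both sets.\<close>
    let ?B = "(\<lambda>x. - x) -` B"
    have [measurable]: "?B \<in> sets borel"
      using measurable_sets[of uminus borel borel B] by simp
    have "emeasure lborel ?B + emeasure lborel (A \<inter> {..a}) \<le> 2 * emeasure lborel C"
    proof (rule emeasure_add_le_of_initial_parts)
      show "?B \<noteq> {}" using ne(2) by (metis all_not_in_conv minus_minus vimageI2)
      fix b assume "b \<in> ?B"
      moreover have "?B \<inter> {..b} = (\<lambda>x. - x) -` (B \<inter> {- b..})" by auto
      ultimately show "emeasure lborel (?B \<inter> {..b}) + emeasure lborel (A \<inter> {..a})
          \<le> 2 * emeasure lborel C"
        using key[OF that, of "- b"] by (simp add: emeasure_lborel_vimage_uminus add.commute del: vimage_Int)
    qed auto
    then show ?thesis by (simp add: emeasure_lborel_vimage_uminus)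
  qed
  then have "emeasure lborel (A \<inter> {..a}) + emeasure lborel B \<le> 2 * emeasure lborel C" if "a \<in> A" for a
    using that by (simp only: add.commute)
  then show ?thesis by (rule emeasure_add_le_of_initial_parts[OF assms(1) ne(1)])
qed

text \<open>Each value is the length of the interval of levels below it; Tonelli exchanges the two
  integrals. An infinite value corresponds to a half-line of levels and needs its own case.\<close>

lemma nn_integral_layer_cake:
  fixes f :: "real \<Rightarrow> ennreal"
  assumes [measurable]: "f \<in> borel_measurable borel"
  shows "(\<integral>\<^sup>+x. f x \<partial>lborel)
    = (\<integral>\<^sup>+t. indicator {0<..} t * emeasure lborel {x. ennreal t < f x} \<partial>lborel)"
proof -
  have level: "f x = (\<integral>\<^sup>+t. indicator {0<..} t * indicator {x. ennreal t < f x} x \<partial>lborel)" for x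
  proof (cases "f x")
    case (real r)
    have "(\<integral>\<^sup>+t. indicator {0<..} t * indicator {x. ennreal t < f x} x \<partial>lborel)
        = (\<integral>\<^sup>+t. indicator {0<..<r} t \<partial>lborel)"
      using real by (intro nn_integral_cong) (auto simp: indicator_def ennreal_less_iff)
    then show ?thesis using real by simp
  next
    case top
    have "(\<integral>\<^sup>+t. indicator {0<..} t * indicator {x. ennreal t < f x} x \<partial>lborel)
        = (\<integral>\<^sup>+t. indicator {0<..} (t::real) \<partial>lborel)"
      using top by (intro nn_integral_cong) (auto simp: indicator_def)
    moreover have "emeasure lborel {0::real<..} = (top :: ennreal)"
    proof (rule ccontr)
      assume "emeasure lborel {0::real<..} \<noteq> (top :: ennreal)"
      then obtain n where "emeasure lborel {0::real<..} < of_nat n"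
        using ennreal_Ex_less_of_nat less_top by metis
      moreover have "emeasure lborel {0<..<real n} \<le> emeasure lborel {0::real<..}"
        by (rule emeasure_mono) auto
      ultimately show False by (simp add: ennreal_of_nat_eq_real_of_nat)
    qed
    ultimately show ?thesis using top by simp
  qed
  have "(\<integral>\<^sup>+x. f x \<partial>lborel)
      = (\<integral>\<^sup>+x. \<integral>\<^sup>+t. indicator {0<..} t * indicator {x. ennreal t < f x} x \<partial>lborel \<partial>lborel)"
    by (intro nn_integral_cong level)
  also have "\<dots> = (\<integral>\<^sup>+t. \<integral>\<^sup>+x. indicator {0<..} t * indicator {x. ennreal t < f x} x \<partial>lborel \<partial>lborel)"
    by (rule lborel_pair.Fubini'[symmetric]) simp
  also have "\<dots> = (\<integral>\<^sup>+t. indicator {0<..} t * emeasure lborel {x. ennreal t < f x} \<partial>lborel)"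
    by (intro nn_integral_cong) (simp add: nn_integral_cmult)
  finally show ?thesis .
qed

text \<open>Equal suprema make the superlevel sets of \<open>f\<close> and \<open>g\<close> nonempty
  at the same levels: both below 1, neither from 1 on. Hence \<open>brunn_minkowski_real\<close>,
  which needs nonempty sets, applies level by level.\<close>

lemma prekopa_leindler_real_normalized:
  fixes f g h :: "real \<Rightarrow> ennreal"
  assumes [measurable]: "f \<in> borel_measurable borel" "g \<in> borel_measurable borel"
      "h \<in> borel_measurable borel"
    and sup: "(SUP x. f x) = 1" "(SUP x. g x) = 1"
    and mid: "\<And>x y. f x * g y \<le> (h ((x + y) / 2))\<^sup>2"
  shows "(\<integral>\<^sup>+x. f x \<partial>lborel) + (\<integral>\<^sup>+x. g x \<partial>lborel) \<le> 2 * (\<integral>\<^sup>+x. h x \<partial>lborel)"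
proof -
  let ?m = "\<lambda>f t. indicator {0<..} t * emeasure lborel {x. ennreal t < (f x :: ennreal)}"
  have le1: "f x \<le> 1" "g x \<le> 1" for x
    using SUP_upper[of x UNIV f] SUP_upper[of x UNIV g] sup by auto
  have "?m f t + ?m g t \<le> 2 * ?m h t" for t
  proof (cases "0 < t \<and> t < 1")
    case True
    have "emeasure lborel {x. ennreal t < f x} + emeasure lborel {x. ennreal t < g x}
        \<le> 2 * emeasure lborel {x. ennreal t < h x}"
    proof (rule brunn_minkowski_real)
      have t1: "ennreal t < 1" using True by (simp add: ennreal_less_one_iff)
      show "{x. ennreal t < f x} \<noteq> {}"
        using less_SUP_iff[of "ennreal t" f UNIV] sup t1 by auto
      show "{x. ennreal t < g x} \<noteq> {}"
        using less_SUP_iff[of "ennreal t" g UNIV] sup t1 by auto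
      fix x y assume xy: "x \<in> {x. ennreal t < f x}" "y \<in> {x. ennreal t < g x}"
      obtain r s where rs: "f x = ennreal r" "g y = ennreal s" "0 \<le> r" "0 \<le> s"
        using le1 by (metis ennreal_cases ennreal_one_neq_top top.extremum_unique)
      then have ts: "t < r" "t < s" using xy True by (auto simp: ennreal_less_iff)
      have "ennreal t < h ((x + y) / 2)"
      proof (rule ccontr)
        assume "\<not> ?thesis"
        then have "(h ((x + y) / 2))\<^sup>2 \<le> (ennreal t)\<^sup>2" by (intro power_mono) auto
        then have "ennreal (r * s) \<le> ennreal (t * t)"
          using mid[of x y] rs True by (simp add: ennreal_mult power2_eq_square)
        then have "r * s \<le> t * t" using True by (simp add: ennreal_le_iff)
        moreover have "t * t < r * s" using ts True by (intro mult_strict_mono) auto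
        ultimately show False by simp
      qed
      then show "(x + y) / 2 \<in> {x. ennreal t < h x}" by simp
    qed auto
    then show ?thesis using True by simp
  next
    case False
    moreover have "{x. ennreal t < f x} = {}" "{x. ennreal t < g x} = {}" if "1 \<le> t"
      using le1 that by (auto simp: not_less intro!: order_trans[OF le1(1)] order_trans[OF le1(2)])
    ultimately show ?thesis by (cases "0 < t") auto
  qed
  then have "(\<integral>\<^sup>+t. ?m f t \<partial>lborel) + (\<integral>\<^sup>+t. ?m g t \<partial>lborel) \<le> 2 * (\<integral>\<^sup>+t. ?m h t \<partial>lborel)"
    by (subst nn_integral_add[symmetric], simp, simp, subst nn_integral_cmult[symmetric], simp)
      (rule nn_integral_mono)
  then show ?thesis
    unfolding nn_integral_layer_cake[OF assms(1)] nn_integral_layer_cake[OF assms(2)]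
      nn_integral_layer_cake[OF assms(3)] .
qed

text \<open>The arithmetic-geometric mean inequality, which turns the additive bound of the
  normalized case into a multiplicative one.\<close>

lemma ennreal_mult_le_square:
  fixes a b c :: ennreal
  assumes "a + b \<le> 2 * c"
  shows "a * b \<le> c\<^sup>2"
proof (cases "c = top")
  case False
  then have "2 * c < top" by (simp add: ennreal_mult_less_top less_top)
  then have "a + b < top" using assms by (rule order_le_less_trans[rotated])
  then obtain x y where xy: "a = ennreal x" "b = ennreal y" "0 \<le> x" "0 \<le> y"
    by (metis ennreal_add_eq_top ennreal_cases less_irrefl)
  obtain z where z: "c = ennreal z" "0 \<le> z" using False by (metis ennreal_cases)
  have "ennreal (x + y) \<le> ennreal (2 * z)"
    using assms xy z by (simp add: ennreal_mult')
  then have "x + y \<le> 2 * z" using z by (simp add: ennreal_le_iff)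
  then have "(x + y)\<^sup>2 \<le> (2 * z)\<^sup>2" using xy by (intro power_mono) auto
  then have "x * y \<le> z\<^sup>2"
    using sum_squares_ge_zero[of "x - y" 0] by (simp add: power2_eq_square algebra_simps)
  then show ?thesis using xy z by (simp add: ennreal_mult'[symmetric] ennreal_power ennreal_leI)
qed (simp add: power2_eq_square ennreal_top_mult)

text \<open>The hypothesis is homogeneous: dividing \<open>f\<close> and \<open>g\<close> by their
  suprema \<open>F\<close> and \<open>G\<close>, and \<open>h\<close> by the square root of
  \<open>F * G\<close>, reduces to the normalized case. Boundedness makes \<open>F\<close> and
  \<open>G\<close> finite.\<close>

lemma prekopa_leindler_real_bounded:
  fixes f g h :: "real \<Rightarrow> ennreal"
  assumes [measurable]: "f \<in> borel_measurable borel" "g \<in> borel_measurable borel"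
      "h \<in> borel_measurable borel"
    and bdd: "\<And>x. f x \<le> of_nat m" "\<And>x. g x \<le> of_nat n"
    and mid: "\<And>x y. f x * g y \<le> (h ((x + y) / 2))\<^sup>2"
  shows "(\<integral>\<^sup>+x. f x \<partial>lborel) * (\<integral>\<^sup>+x. g x \<partial>lborel) \<le> (\<integral>\<^sup>+x. h x \<partial>lborel)\<^sup>2"
proof (cases "(SUP x. f x) = 0 \<or> (SUP x. g x) = 0")
  case True
  then have "(\<forall>x. f x = 0) \<or> (\<forall>x. g x = 0)"
    by (metis SUP_upper UNIV_I le_zero_eq)
  then show ?thesis by auto
next
  case False
  have "(SUP x. f x) \<noteq> top" "(SUP x. g x) \<noteq> top"
    using SUP_least[of UNIV f "of_nat m"] SUP_least[of UNIV g "of_nat n"] bdd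
    by (metis ennreal_of_nat_neq_top top.extremum_unique UNIV_I)+
  then obtain F G where FG: "(SUP x. f x) = ennreal F" "(SUP x. g x) = ennreal G" "0 \<le> F" "0 \<le> G"
    by (metis ennreal_cases)
  with False have pos: "0 < F" "0 < G" by (auto simp: less_le)
  define H where "H = sqrt (F * G)"
  have H: "0 < H" "H * H = F * G" using pos by (auto simp: H_def)
  have inv: "ennreal (1 / r) * ennreal r = 1" if "0 < r" for r
    using that by (simp add: ennreal_mult'[symmetric])
  let ?f = "\<lambda>x. ennreal (1 / F) * f x" and ?g = "\<lambda>x. ennreal (1 / G) * g x"
    and ?h = "\<lambda>x. ennreal (1 / H) * h x"
  have "(\<integral>\<^sup>+x. ?f x \<partial>lborel) + (\<integral>\<^sup>+x. ?g x \<partial>lborel) \<le> 2 * (\<integral>\<^sup>+x. ?h x \<partial>lborel)"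
  proof (rule prekopa_leindler_real_normalized)
    show "(SUP x. ?f x) = 1" "(SUP x. ?g x) = 1"
      using FG inv pos by (simp_all add: SUP_mult_left_ennreal[symmetric])
    fix x y
    have "?f x * ?g y = ennreal (1 / F * (1 / G)) * (f x * g y)"
      using pos by (simp add: ennreal_mult mult_ac del: times_divide_eq_right times_divide_eq_left)
    also have "\<dots> \<le> ennreal (1 / F * (1 / G)) * (h ((x + y) / 2))\<^sup>2"
      by (intro mult_left_mono mid) simp
    also have "1 / F * (1 / G) = (1 / H) * (1 / H)" using H by simp
    also have "ennreal ((1 / H) * (1 / H)) * (h ((x + y) / 2))\<^sup>2 = (?h ((x + y) / 2))\<^sup>2"
      using H by (simp add: ennreal_mult power2_eq_square mult_ac
          del: times_divide_eq_right times_divide_eq_left)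
    finally show "?f x * ?g y \<le> (?h ((x + y) / 2))\<^sup>2" .
  qed auto
  then have "(\<integral>\<^sup>+x. ?f x \<partial>lborel) * (\<integral>\<^sup>+x. ?g x \<partial>lborel) \<le> (\<integral>\<^sup>+x. ?h x \<partial>lborel)\<^sup>2"
    by (rule ennreal_mult_le_square)
  then have le: "ennreal (1 / F) * (\<integral>\<^sup>+x. f x \<partial>lborel) * (ennreal (1 / G) * (\<integral>\<^sup>+x. g x \<partial>lborel))
      \<le> (ennreal (1 / H) * (\<integral>\<^sup>+x. h x \<partial>lborel))\<^sup>2"
    by (simp add: nn_integral_cmult)
  have "(\<integral>\<^sup>+x. f x \<partial>lborel) * (\<integral>\<^sup>+x. g x \<partial>lborel)
      = (ennreal (1 / F) * ennreal F) * (ennreal (1 / G) * ennreal G)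
        * ((\<integral>\<^sup>+x. f x \<partial>lborel) * (\<integral>\<^sup>+x. g x \<partial>lborel))"
    using inv pos by simp
  also have "\<dots> = ennreal F * ennreal G *
      (ennreal (1 / F) * (\<integral>\<^sup>+x. f x \<partial>lborel) * (ennreal (1 / G) * (\<integral>\<^sup>+x. g x \<partial>lborel)))"
    by (simp only: mult_ac)
  also have "\<dots> \<le> ennreal F * ennreal G * (ennreal (1 / H) * (\<integral>\<^sup>+x. h x \<partial>lborel))\<^sup>2"
    by (intro mult_left_mono le) simp
  also have "ennreal F * ennreal G = ennreal H * ennreal H"
    using H pos by (simp add: ennreal_mult'[symmetric])
  also have "ennreal H * ennreal H * (ennreal (1 / H) * (\<integral>\<^sup>+x. h x \<partial>lborel))\<^sup>2
      = (ennreal (1 / H) * ennreal H) * (ennreal (1 / H) * ennreal H) * (\<integral>\<^sup>+x. h x \<partial>lborel)\<^sup>2"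
    by (simp only: power2_eq_square mult_ac)
  also have "\<dots> = (\<integral>\<^sup>+x. h x \<partial>lborel)\<^sup>2" using inv H by simp
  finally show ?thesis .
qed

lemma nn_integral_SUP_truncate:
  fixes f :: "'a \<Rightarrow> ennreal"
  assumes [measurable]: "f \<in> borel_measurable M"
  shows "(\<integral>\<^sup>+x. f x \<partial>M) = (SUP n. \<integral>\<^sup>+x. min (f x) (of_nat n) \<partial>M)"
proof -
  have "(SUP n. min (f x) (of_nat n)) = f x" for x
  proof (rule antisym)
    show "f x \<le> (SUP n. min (f x) (of_nat n))"
    proof (cases "f x = top")
      case True
      then show ?thesis by (simp add: ennreal_SUP_of_nat_eq_top)
    next
      case False
      then obtain n where "f x < of_nat n" using ennreal_Ex_less_of_nat[of "f x"] by (auto simp: less_top)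
      then have "f x = min (f x) (of_nat n)" by simp
      also have "\<dots> \<le> (SUP n. min (f x) (of_nat n))" by (rule SUP_upper) simp
      finally show ?thesis .
    qed
  qed (auto intro: SUP_least)
  then have "(\<integral>\<^sup>+x. f x \<partial>M) = (\<integral>\<^sup>+x. (SUP n. min (f x) (of_nat n)) \<partial>M)" by simp
  also have "\<dots> = (SUP n. \<integral>\<^sup>+x. min (f x) (of_nat n) \<partial>M)"
    by (rule nn_integral_monotone_convergence_SUP)
      (auto simp: incseq_def le_fun_def min_def intro: order_trans)
  finally show ?thesis .
qed

text \<open>Truncating \<open>f\<close> and \<open>g\<close> but not \<open>h\<close> preserves the
  hypothesis, and monotone convergence removes the two truncations independently.\<close>

theorem prekopa_leindler_real:
  fixes f g h :: "real \<Rightarrow> ennreal"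
  assumes [measurable]: "f \<in> borel_measurable borel" "g \<in> borel_measurable borel"
      "h \<in> borel_measurable borel"
    and mid: "\<And>x y. f x * g y \<le> (h ((x + y) / 2))\<^sup>2"
  shows "(\<integral>\<^sup>+x. f x \<partial>lborel) * (\<integral>\<^sup>+x. g x \<partial>lborel) \<le> (\<integral>\<^sup>+x. h x \<partial>lborel)\<^sup>2"
proof -
  have "(\<integral>\<^sup>+x. min (f x) (of_nat m) \<partial>lborel) * (\<integral>\<^sup>+x. min (g x) (of_nat n) \<partial>lborel)
      \<le> (\<integral>\<^sup>+x. h x \<partial>lborel)\<^sup>2" for m n
  proof (rule prekopa_leindler_real_bounded[where m = m and n = n])
    fix x y
    have "min (f x) (of_nat m) * min (g y) (of_nat n) \<le> f x * g y" by (intro mult_mono) auto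
    then show "min (f x) (of_nat m) * min (g y) (of_nat n) \<le> (h ((x + y) / 2))\<^sup>2"
      using mid order_trans by blast
  qed auto
  then show ?thesis
    by (simp add: nn_integral_SUP_truncate[of f] nn_integral_SUP_truncate[of g]
        SUP_mult_left_ennreal SUP_mult_right_ennreal SUP_least)
qed

section \<open>Tensorization over the coordinates\<close>

interpretation lborel_product: product_sigma_finite "\<lambda>_. lborel :: real measure" ..

lemma prekopa_leindler_PiM:
  fixes f g h :: "('i \<Rightarrow> real) \<Rightarrow> ennreal"
  assumes "finite I"
    and "f \<in> borel_measurable (\<Pi>\<^sub>M i\<in>I. lborel)" "g \<in> borel_measurable (\<Pi>\<^sub>M i\<in>I. lborel)"
      "h \<in> borel_measurable (\<Pi>\<^sub>M i\<in>I. lborel)"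
    and "\<And>x y. x \<in> extensional I \<Longrightarrow> y \<in> extensional I \<Longrightarrow> f x * g y \<le> (h (\<lambda>i\<in>I. (x i + y i) / 2))\<^sup>2"
  shows "(\<integral>\<^sup>+x. f x \<partial>(\<Pi>\<^sub>M i\<in>I. lborel)) * (\<integral>\<^sup>+x. g x \<partial>(\<Pi>\<^sub>M i\<in>I. lborel))
    \<le> (\<integral>\<^sup>+x. h x \<partial>(\<Pi>\<^sub>M i\<in>I. lborel))\<^sup>2"
  using assms
proof (induction I arbitrary: f g h rule: finite_induct)
  case empty
  have "(\<lambda>i\<in>{}. (undefined i + undefined i) / 2) = (\<lambda>i::'i. undefined :: real)"
    by (simp add: restrict_def fun_eq_iff)
  with empty(4)[of "\<lambda>_. undefined" "\<lambda>_. undefined"] show ?case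
    by (simp add: lborel_product.nn_integral_empty restrict_def)
next
  case (insert k I)
  note [measurable] = insert.prems(1-3)
  let ?P = "\<Pi>\<^sub>M i\<in>I. (lborel :: real measure)"
  have meas: "(\<lambda>x. u (x(k := t))) \<in> borel_measurable ?P"
    if "u \<in> borel_measurable (\<Pi>\<^sub>M i\<in>insert k I. lborel)" for u :: "('i \<Rightarrow> real) \<Rightarrow> ennreal" and t
    by (rule measurable_compose[OF _ that]) (rule measurable_fun_upd[where J=I], auto)
  have meas': "(\<lambda>t. \<integral>\<^sup>+x. u (x(k := t)) \<partial>?P) \<in> borel_measurable borel"
    if [measurable]: "u \<in> borel_measurable (\<Pi>\<^sub>M i\<in>insert k I. lborel)" for u :: "('i \<Rightarrow> real) \<Rightarrow> ennreal"
  proof -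
    interpret sigma_finite_measure ?P using lborel_product.sigma_finite[OF insert.hyps(1)] .
    show ?thesis by measurable
  qed
  have "(\<integral>\<^sup>+t. \<integral>\<^sup>+x. f (x(k := t)) \<partial>?P \<partial>lborel) * (\<integral>\<^sup>+t. \<integral>\<^sup>+x. g (x(k := t)) \<partial>?P \<partial>lborel)
      \<le> (\<integral>\<^sup>+t. \<integral>\<^sup>+x. h (x(k := t)) \<partial>?P \<partial>lborel)\<^sup>2"
  proof (intro prekopa_leindler_real meas' insert.prems(1-3))
    fix s t
    show "(\<integral>\<^sup>+x. f (x(k := s)) \<partial>?P) * (\<integral>\<^sup>+x. g (x(k := t)) \<partial>?P)
        \<le> (\<integral>\<^sup>+x. h (x(k := (s + t) / 2)) \<partial>?P)\<^sup>2"
    proof (intro insert.IH meas insert.prems(1-3))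
      fix x y :: "'i \<Rightarrow> real" assume "x \<in> extensional I" "y \<in> extensional I"
      then have "f (x(k := s)) * g (y(k := t))
          \<le> (h (\<lambda>i\<in>insert k I. ((x(k := s)) i + (y(k := t)) i) / 2))\<^sup>2"
        by (intro insert.prems(4)) (auto simp: extensional_def)
      also have "(\<lambda>i\<in>insert k I. ((x(k := s)) i + (y(k := t)) i) / 2)
          = (\<lambda>i\<in>I. (x i + y i) / 2)(k := (s + t) / 2)"
        using insert.hyps(2) by (auto simp: restrict_def fun_eq_iff)
      finally show "f (x(k := s)) * g (y(k := t))
          \<le> (h ((\<lambda>i\<in>I. (x i + y i) / 2)(k := (s + t) / 2)))\<^sup>2" .
    qed
  qed
  then show ?case
    by (simp only: insert.prems(1-3)[THEN lborel_product.product_nn_integral_insert_rev[OF insert.hyps]])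
qed

theorem prekopa_leindler:
  fixes f g h :: "'a::euclidean_space \<Rightarrow> ennreal"
  assumes [measurable]: "f \<in> borel_measurable borel" "g \<in> borel_measurable borel"
      "h \<in> borel_measurable borel"
    and mid: "\<And>x y. f x * g y \<le> (h ((1 / 2) *\<^sub>R (x + y)))\<^sup>2"
  shows "(\<integral>\<^sup>+x. f x \<partial>lborel) * (\<integral>\<^sup>+x. g x \<partial>lborel) \<le> (\<integral>\<^sup>+x. h x \<partial>lborel)\<^sup>2"
proof -
  let ?T = "\<lambda>c. \<Sum>b\<in>Basis. c b *\<^sub>R (b :: 'a)"
  let ?P = "\<Pi>\<^sub>M b\<in>(Basis :: 'a set). (lborel :: real measure)"
  have [measurable]: "?T \<in> measurable ?P borel" by measurable
  have "(\<integral>\<^sup>+c. f (?T c) \<partial>?P) * (\<integral>\<^sup>+c. g (?T c) \<partial>?P) \<le> (\<integral>\<^sup>+c. h (?T c) \<partial>?P)\<^sup>2"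
  proof (rule prekopa_leindler_PiM)
    fix x y :: "'a \<Rightarrow> real"
    have "(1 / 2) *\<^sub>R (?T x + ?T y) = ?T (\<lambda>b\<in>Basis. (x b + y b) / 2)"
      by (simp add: sum.distrib[symmetric] scaleR_sum_right algebra_simps add_divide_distrib)
    then show "f (?T x) * g (?T y) \<le> (h (?T (\<lambda>b\<in>Basis. (x b + y b) / 2)))\<^sup>2"
      using mid[of "?T x" "?T y"] by simp
  qed auto
  moreover have "(\<integral>\<^sup>+x. u x \<partial>lborel) = (\<integral>\<^sup>+c. u (?T c) \<partial>?P)"
    if [measurable]: "u \<in> borel_measurable borel" for u :: "'a \<Rightarrow> ennreal"
    unfolding lborel_eq[where 'a = 'a] by (rule nn_integral_distr) auto
  ultimately show ?thesis by simp
qed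

corollary brunn_minkowski_midpoint:
  fixes A B C :: "'a::euclidean_space set"
  assumes [measurable]: "A \<in> sets borel" "B \<in> sets borel" "C \<in> sets borel"
    and mid: "\<And>x y. x \<in> A \<Longrightarrow> y \<in> B \<Longrightarrow> (1 / 2) *\<^sub>R (x + y) \<in> C"
  shows "emeasure lborel A * emeasure lborel B \<le> (emeasure lborel C)\<^sup>2"
proof -
  have "(\<integral>\<^sup>+x. indicator A x \<partial>lborel) * (\<integral>\<^sup>+x. indicator B x \<partial>lborel)
      \<le> (\<integral>\<^sup>+x. indicator C x \<partial>lborel)\<^sup>2"
    using mid by (intro prekopa_leindler) (auto simp: indicator_def)
  then show ?thesis by simp
qed

subsection \<open>Symmetric log-concave distributions on the line\<close>

text \<open>With S the partial sums of \<open>f\<close>, the difference on the left is the sum over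
  k < n of (p k - p (k+1)) * S (k+1), and the weights are nonnegative. The boundary term stays on
  the left so that the induction closes; it vanishes in the application because the last cell is
  null.\<close>

lemma abel_summation_bound:
  fixes p f :: "nat \<Rightarrow> real"
  assumes "\<And>k. 0 \<le> p k" "\<And>k. p (Suc k) \<le> p k"
    and "\<And>k. k \<le> n \<Longrightarrow> \<bar>\<Sum>j<k. f j\<bar> \<le> a + b * real k"
    and "0 \<le> a"
  shows "\<bar>(\<Sum>k<n. p k * f k) - p n * (\<Sum>k<n. f k)\<bar>
    \<le> a * (p 0 - p n) + b * ((\<Sum>k<n. p k) - real n * p n)"
  using assms(3)
proof (induction n)
  case (Suc n)
  let ?S = "\<Sum>k<Suc n. f k"
  have "(\<Sum>k<Suc n. p k * f k) - p (Suc n) * ?S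
      = ((\<Sum>k<n. p k * f k) - p n * (\<Sum>k<n. f k)) + (p n - p (Suc n)) * ?S"
    by (simp add: algebra_simps)
  also have "\<bar>\<dots>\<bar> \<le> (a * (p 0 - p n) + b * ((\<Sum>k<n. p k) - real n * p n))
      + (p n - p (Suc n)) * (a + b * real (Suc n))"
  proof (rule order_trans[OF abs_triangle_ineq add_mono])
    show "\<bar>(p n - p (Suc n)) * ?S\<bar> \<le> (p n - p (Suc n)) * (a + b * real (Suc n))"
      using assms(2)[of n] Suc.prems[of "Suc n"] by (simp add: abs_mult mult_left_mono)
  qed (use Suc in auto)
  also have "\<dots> = a * (p 0 - p (Suc n)) + b * ((\<Sum>k<Suc n. p k) - real (Suc n) * p (Suc n))"
    by (simp add: algebra_simps)
  finally show ?case .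
qed (use assms in auto)

text \<open>The finite sum has a closed form: 1 + q minus a nonnegative remainder. It serves as the
  second moment of a geometric tail, 2k + 1 being the increment of k^2.\<close>

lemma sum_odd_powers_bound:
  fixes q :: real
  assumes "0 \<le> q" "q \<le> 1"
  shows "(1 - q)\<^sup>2 * (\<Sum>k<n. (2 * real k + 1) * q ^ k) \<le> 2"
proof -
  have "(1 - q)\<^sup>2 * (\<Sum>k<n. (2 * real k + 1) * q ^ k)
      = 1 + q - q ^ n * ((2 * real n + 1) - (2 * real n - 1) * q)"
    by (induction n) (simp_all add: algebra_simps power2_eq_square)
  moreover have "(2 * real n - 1) * q \<le> 2 * real n + 1"
  proof -
    have "real n * q \<le> real n" using assms by (simp add: mult_left_le)
    then show ?thesis using assms by (simp add: algebra_simps)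
  qed
  moreover from this assms have "0 \<le> q ^ n * ((2 * real n + 1) - (2 * real n - 1) * q)" by simp
  ultimately show ?thesis using assms by linarith
qed

lemma ex_nat_multiple_interval:
  fixes d x :: real
  assumes "0 < d" "0 \<le> x"
  shows "\<exists>m::nat. real m * d \<le> x \<and> x < (real m + 1) * d"
proof -
  have "real (nat \<lfloor>x / d\<rfloor>) = of_int \<lfloor>x / d\<rfloor>" using assms by simp
  then have "real (nat \<lfloor>x / d\<rfloor>) \<le> x / d" "x / d < real (nat \<lfloor>x / d\<rfloor>) + 1" by linarith+
  then show ?thesis using assms(1) by (intro exI[of _ "nat \<lfloor>x / d\<rfloor>"]) (simp add: field_simps)
qed

lemma vimage_uminus_in_borel [measurable, simp]:
  fixes A :: "real set"
  shows "A \<in> sets borel \<Longrightarrow> uminus -` A \<in> sets borel"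
  using measurable_sets[of uminus borel borel A] by simp

text \<open>The axiom \<open>midpoint\<close> is log-concavity for sets; applied to half-lines and
  to intervals it makes tails and cells of any mesh log-concave. The strict bound by
  \<open>R\<close> makes the closed half-line from \<open>R\<close> on null, so a grid may end
  exactly at \<open>R\<close>.\<close>

locale symmetric_log_concave_distribution = real_distribution M for M +
  fixes R :: real
  assumes symmetric: "A \<in> sets borel \<Longrightarrow> prob (uminus -` A) = prob A"
    and nonatomic: "prob {x} = 0"
    and R_pos: "0 < R"
    and bounded: "AE x in M. \<bar>x\<bar> < R"
    and midpoint: "A \<in> sets borel \<Longrightarrow> B \<in> sets borel \<Longrightarrow> C \<in> sets borel \<Longrightarrow>
      (\<And>x y. x \<in> A \<Longrightarrow> y \<in> B \<Longrightarrow> (x + y) / 2 \<in> C) \<Longrightarrow> prob A * prob B \<le> (prob C)\<^sup>2"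
begin

section \<open>Masses of tails and cells on a grid of mesh \<open>d\<close>\<close>

definition tail :: "real \<Rightarrow> nat \<Rightarrow> real" where
  "tail d k = prob {real k * d..}"

definition cell :: "real \<Rightarrow> nat \<Rightarrow> real" where
  "cell d k = prob {real k * d..<real (Suc k) * d}"

lemma tail_0: "tail d 0 = 1 / 2"
proof -
  have "prob (uminus -` {0..}) = prob {0..}" by (rule symmetric) simp
  moreover have "uminus -` {0..} = {..0::real}" by auto
  ultimately have "prob {..0} = prob {0..}" by simp
  moreover have "prob ({..0} \<union> {0<..}) = prob {..0} + prob {0<..}"
    by (rule finite_measure_Union) auto
  moreover have "prob ({0} \<union> {0<..}) = prob {0} + prob {0<..}"
    by (rule finite_measure_Union) auto
  moreover have "{..0} \<union> {0<..} = (UNIV :: real set)" "{0} \<union> {0<..} = {0::real..}" by auto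
  ultimately show ?thesis using prob_space nonatomic[of 0] by (simp add: tail_def)
qed

lemma tail_nonneg: "0 \<le> tail d k" and cell_nonneg: "0 \<le> cell d k"
  by (simp_all add: tail_def cell_def)

lemma tail_Suc: "0 < d \<Longrightarrow> tail d (Suc k) = tail d k - cell d k"
proof -
  assume "0 < d"
  then have "{real k * d..} = {real k * d..<real (Suc k) * d} \<union> {real (Suc k) * d..}"
    by (auto simp: algebra_simps)
  moreover have "prob ({real k * d..<real (Suc k) * d} \<union> {real (Suc k) * d..})
      = prob {real k * d..<real (Suc k) * d} + prob {real (Suc k) * d..}"
    by (rule finite_measure_Union) auto
  ultimately have "prob {real k * d..} = prob {real k * d..<real (Suc k) * d} + prob {real (Suc k) * d..}"
    by simp
  then show ?thesis by (simp add: tail_def cell_def)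
qed

lemma tail_eq_0: "R \<le> real n * d \<Longrightarrow> tail d n = 0"
proof -
  assume "R \<le> real n * d"
  then have "AE x in M. x \<notin> {real n * d..}" by (intro eventually_mono[OF bounded]) auto
  then show ?thesis by (simp add: tail_def prob_eq_0)
qed

lemma sum_cell: "0 < d \<Longrightarrow> (\<Sum>k<n. cell d k) = 1 / 2 - tail d n"
  by (induction n) (simp_all add: tail_0 tail_Suc)

lemma tail_log_concave:
  assumes "0 < d"
  shows "tail d k * tail d (Suc (Suc k)) \<le> (tail d (Suc k))\<^sup>2"
  unfolding tail_def by (rule midpoint) (auto simp: field_simps)

lemma cell_log_concave:
  assumes "0 < d"
  shows "cell d k * cell d (Suc (Suc k)) \<le> (cell d (Suc k))\<^sup>2"
  unfolding cell_def by (rule midpoint) (auto simp: field_simps)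

lemma cell_reflect:
  "prob {- (real (Suc k) * d)<..- (real k * d)} = cell d k"
proof -
  have "uminus -` {real k * d..<real (Suc k) * d} = {- (real (Suc k) * d)<..- (real k * d)}"
    by auto
  then show ?thesis using symmetric[of "{real k * d..<real (Suc k) * d}"] by (simp add: cell_def)
qed

text \<open>Midpoints between a cell and its mirror image fall in (-d, d). If the first cell were
  null, so would be this interval, hence every cell, although the cells up to \<open>R\<close> have
  total mass 1/2.\<close>

lemma cell_0_pos:
  assumes "0 < d"
  shows "0 < cell d 0"
proof (rule ccontr)
  assume "\<not> ?thesis"
  then have c0: "cell d 0 = 0" using cell_nonneg[of d 0] by simp
  have "cell d k = 0" for k
  proof -
    have le: "cell d k * prob {- (real (Suc k) * d)<..- (real k * d)} \<le> (prob {- d<..<d})\<^sup>2"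
      unfolding cell_def by (rule midpoint) (use assms in \<open>auto simp: field_simps\<close>)
    have "prob {- d<..<d} \<le> prob ({- d<..0} \<union> {0..<d})"
      by (rule finite_measure_mono) auto
    moreover have "prob ({- d<..0} \<union> {0..<d}) \<le> prob {- d<..0} + prob {0..<d}"
      by (rule measure_Un_le) auto
    moreover have "prob {- d<..0} = 0" "prob {0..<d} = 0"
      using c0 cell_reflect[of 0 d] by (simp_all add: cell_def)
    moreover have "0 \<le> prob {- d<..<d}" by (rule measure_nonneg)
    ultimately have "prob {- d<..<d} = 0" by linarith
    with le have "cell d k * cell d k \<le> 0" by (simp add: cell_reflect del: of_nat_Suc)
    then show ?thesis using cell_nonneg[of d k] by (simp add: mult_le_0_iff)
  qed
  moreover obtain n where "R / d \<le> real n" using real_arch_simple by blast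
  ultimately show False
    using sum_cell[OF assms, of n] tail_eq_0[of n d] assms by (simp add: field_simps)
qed

text \<open>Log-concavity lets no ratio of consecutive tails exceed the first one, which is (1/2 -
  \<open>cell d 0\<close>) / (1/2).\<close>

lemma tail_Suc_le:
  assumes "0 < d"
  shows "tail d (Suc k) \<le> (1 - 2 * cell d 0) * tail d k"
proof (induction k)
  case 0
  then show ?case by (simp add: tail_Suc[OF assms] tail_0)
next
  case (Suc k)
  show ?case
  proof (cases "tail d k = 0")
    case True
    then have "tail d (Suc k) = 0"
      using tail_Suc[OF assms, of k] cell_nonneg[of d k] tail_nonneg[of d "Suc k"] by linarith
    then show ?thesis using tail_Suc[OF assms, of "Suc k"] cell_nonneg[of d "Suc k"] by simp
  next
    case False
    then have pos: "0 < tail d k" using tail_nonneg[of d k] by simp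
    have "tail d k * tail d (Suc (Suc k)) \<le> tail d (Suc k) * tail d (Suc k)"
      using tail_log_concave[OF assms, of k] by (simp add: power2_eq_square)
    also have "\<dots> \<le> ((1 - 2 * cell d 0) * tail d k) * tail d (Suc k)"
      by (intro mult_right_mono Suc.IH tail_nonneg)
    finally show ?thesis using pos by (simp add: mult_ac)
  qed
qed

lemma tail_le_power:
  assumes "0 < d"
  shows "2 * tail d k \<le> (1 - 2 * cell d 0) ^ k"
proof (induction k)
  case 0
  then show ?case by (simp add: tail_0)
next
  case (Suc k)
  have "0 \<le> 1 - 2 * cell d 0"
    using tail_Suc[OF assms, of 0] tail_nonneg[of d 1] by (simp add: tail_0)
  then have "(1 - 2 * cell d 0) * (2 * tail d k) \<le> (1 - 2 * cell d 0) * (1 - 2 * cell d 0) ^ k"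
    by (intro mult_left_mono Suc.IH)
  then show ?case using tail_Suc_le[OF assms, of k] by simp
qed

text \<open>For the first step, midpoints between cell 1 and the mirror image of cell 0 lie in cell
  0. Log-concavity of the cells then propagates the inequality.\<close>

lemma cell_decreasing:
  assumes "0 < d"
  shows "cell d (Suc k) \<le> cell d k"
proof (induction k)
  case 0
  have "cell d 1 * prob {- (real (Suc 0) * d)<..- (real 0 * d)} \<le> (cell d 0)\<^sup>2"
    unfolding cell_def by (rule midpoint) (use assms in \<open>auto simp: field_simps\<close>)
  then show ?case using cell_0_pos[OF assms] cell_reflect[of 0 d] by (simp add: power2_eq_square)
next
  case (Suc k)
  show ?case
  proof (cases "cell d (Suc k) = 0")
    \<comment> \<open>No internal zeros: a null cell leaves the tail unchanged, but tails shrink by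
      a factor below 1, so the tail is 0 and every later cell is null.\<close>
    case True
    then have "tail d (Suc k) \<le> (1 - 2 * cell d 0) * tail d (Suc k)"
      using tail_Suc_le[OF assms, of "Suc k"] tail_Suc[OF assms, of "Suc k"] by simp
    then have "cell d 0 * tail d (Suc k) \<le> 0" by (simp add: algebra_simps)
    then have "tail d (Suc k) \<le> 0" using cell_0_pos[OF assms] by (simp add: mult_le_0_iff)
    then show ?thesis
      using tail_nonneg[of d "Suc (Suc (Suc k))"] tail_Suc[OF assms, of "Suc k"]
        tail_Suc[OF assms, of "Suc (Suc k)"] cell_nonneg[of d] by (simp add: True)
  next
    case False
    then have pos: "0 < cell d (Suc k)" using cell_nonneg[of d "Suc k"] by simp
    have "cell d k * cell d (Suc (Suc k)) \<le> cell d (Suc k) * cell d (Suc k)"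
      using cell_log_concave[OF assms, of k] by (simp add: power2_eq_square)
    also have "\<dots> \<le> cell d k * cell d (Suc k)" by (intro mult_right_mono Suc.IH cell_nonneg)
    finally show ?thesis using pos Suc.IH by simp
  qed
qed

text \<open>A discrete layer cake: on the cell with index m, x^2 is at most ((m+1) d)^2, which is
  the sum of d^2 (2k+1) over the levels k d \<le> |x|. The level probabilities are at most q^k with
  1 - q = 2 * \<open>cell d 0\<close>, and the sum over odd weights gives 4
  (\<open>cell d 0\<close>)^2 times the second moment \<le> 2 d^2.\<close>

lemma cell_0_times_variance_le:
  assumes d: "0 < d"
  shows "2 * (cell d 0)\<^sup>2 * (\<integral>x. x\<^sup>2 \<partial>M) \<le> d\<^sup>2"
proof -
  obtain n where "R / d \<le> real n" using real_arch_simple by blast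
  then have n: "R \<le> real n * d" using d by (simp add: field_simps)
  let ?g = "\<lambda>x. \<Sum>k<n. d\<^sup>2 * (2 * real k + 1) * indicator {x. real k * d \<le> \<bar>x\<bar>} x"
  have pointwise: "x\<^sup>2 \<le> ?g x" if "\<bar>x\<bar> < R" for x
  proof -
    obtain m :: nat where m': "real m * d \<le> \<bar>x\<bar>" "\<bar>x\<bar> < (real m + 1) * d"
      using ex_nat_multiple_interval[OF d abs_ge_zero] by blast
    have "real m * d < real n * d" using m'(1) that n by linarith
    then have "m < n" using d by simp
    have "x\<^sup>2 \<le> ((real m + 1) * d)\<^sup>2" using m'(2) by (intro abs_le_square_iff[THEN iffD1]) linarith
    also have "\<dots> = (\<Sum>k<Suc m. d\<^sup>2 * (2 * real k + 1))"
      by (induction m) (simp_all add: power2_eq_square algebra_simps)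
    also have "\<dots> = (\<Sum>k<Suc m. d\<^sup>2 * (2 * real k + 1) * indicator {x. real k * d \<le> \<bar>x\<bar>} x)"
    proof (rule sum.cong)
      fix k assume "k \<in> {..<Suc m}"
      then have "real k * d \<le> real m * d" using d by simp
      then show "d\<^sup>2 * (2 * real k + 1) = d\<^sup>2 * (2 * real k + 1) * indicator {x. real k * d \<le> \<bar>x\<bar>} x"
        using m'(1) by simp
    qed simp
    also have "\<dots> \<le> ?g x" using \<open>m < n\<close> by (intro sum_mono2) auto
    finally show ?thesis .
  qed
  have prob_abs: "prob {x. real k * d \<le> \<bar>x\<bar>} \<le> 2 * tail d k" for k
  proof -
    have "prob {x. real k * d \<le> \<bar>x\<bar>} \<le> prob ({real k * d..} \<union> uminus -` {real k * d..})"
      by (rule finite_measure_mono) (auto simp: abs_if split: if_splits)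
    also have "\<dots> \<le> prob {real k * d..} + prob (uminus -` {real k * d..})"
      by (rule measure_Un_le) auto
    finally show ?thesis using symmetric[of "{real k * d..}"] by (simp add: tail_def)
  qed
  let ?q = "1 - 2 * cell d 0"
  have q: "0 \<le> ?q" "?q \<le> 1"
    using tail_Suc[OF d, of 0] tail_nonneg[of d 1] cell_nonneg[of d 0] by (simp_all add: tail_0)
  have "(\<integral>x. x\<^sup>2 \<partial>M) \<le> (\<integral>x. ?g x \<partial>M)"
  proof (rule integral_mono_AE)
    show "integrable M (\<lambda>x. x\<^sup>2)"
    proof (rule integrable_const_bound[where B = "R\<^sup>2"])
      show "AE x in M. norm (x\<^sup>2) \<le> R\<^sup>2"
        using bounded by eventually_elim (auto simp: abs_le_square_iff[symmetric])
    qed auto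
    show "AE x in M. x\<^sup>2 \<le> ?g x" using bounded by eventually_elim (rule pointwise)
    show "integrable M ?g"
      by (intro Bochner_Integration.integrable_sum integrable_mult_right integrable_real_indicator)
        (auto simp: emeasure_eq_measure)
  qed
  also have "(\<integral>x. ?g x \<partial>M) = (\<Sum>k<n. d\<^sup>2 * (2 * real k + 1) * prob {x. real k * d \<le> \<bar>x\<bar>})"
    by (subst Bochner_Integration.integral_sum)
      (auto intro!: integrable_real_indicator simp: emeasure_eq_measure)
  also have "\<dots> \<le> (\<Sum>k<n. d\<^sup>2 * (2 * real k + 1) * ?q ^ k)"
    by (intro sum_mono mult_left_mono order_trans[OF prob_abs tail_le_power[OF d]]) auto
  also have "\<dots> = d\<^sup>2 * (\<Sum>k<n. (2 * real k + 1) * ?q ^ k)"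
    by (simp add: sum_distrib_left mult.assoc)
  finally have "(1 - ?q)\<^sup>2 * (\<integral>x. x\<^sup>2 \<partial>M) \<le> (1 - ?q)\<^sup>2 * (d\<^sup>2 * (\<Sum>k<n. (2 * real k + 1) * ?q ^ k))"
    by (intro mult_left_mono) auto
  also have "\<dots> = d\<^sup>2 * ((1 - ?q)\<^sup>2 * (\<Sum>k<n. (2 * real k + 1) * ?q ^ k))" by (simp only: mult_ac)
  also have "\<dots> \<le> d\<^sup>2 * 2" by (intro mult_left_mono sum_odd_powers_bound q) auto
  finally show ?thesis by (simp add: power_mult_distrib mult_ac)
qed

lemma cell_0_le:
  assumes "0 < d" "0 < L" "L\<^sup>2 \<le> (\<integral>x. x\<^sup>2 \<partial>M)"
  shows "cell d 0 / d \<le> 1 / L"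
proof -
  have "2 * (cell d 0)\<^sup>2 * L\<^sup>2 \<le> 2 * (cell d 0)\<^sup>2 * (\<integral>x. x\<^sup>2 \<partial>M)"
    by (intro mult_left_mono assms) auto
  also have "\<dots> \<le> d\<^sup>2" by (rule cell_0_times_variance_le[OF assms(1)])
  finally have "(cell d 0 * L)\<^sup>2 \<le> d\<^sup>2"
    using zero_le_power2[of "cell d 0 * L"] unfolding power_mult_distrib by linarith
  then have "cell d 0 * L \<le> d" by (rule power2_le_imp_le) (use assms(1) in simp)
  then show ?thesis using assms by (simp add: field_simps)
qed

section \<open>Expectations of odd and even functions\<close>

lemma distr_uminus: "distr M borel uminus = M"
proof (rule measure_eqI)
  fix A assume "A \<in> sets (distr M borel uminus)"
  then have A: "A \<in> sets borel" by simp
  then show "emeasure (distr M borel uminus) A = emeasure M A"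
    using symmetric[OF A] by (simp add: emeasure_distr emeasure_eq_measure)
qed simp

lemma integral_odd:
  fixes f :: "real \<Rightarrow> real"
  assumes [measurable]: "f \<in> borel_measurable borel" and odd: "\<And>x. f (- x) = - f x"
  shows "(\<integral>x. f x \<partial>M) = 0"
proof -
  have "(\<integral>x. f x \<partial>M) = (\<integral>x. f x \<partial>distr M borel uminus)" by (simp add: distr_uminus)
  also have "\<dots> = (\<integral>x. f (- x) \<partial>M)" by (rule integral_distr) auto
  also have "\<dots> = - (\<integral>x. f x \<partial>M)" by (simp add: odd)
  finally show ?thesis by simp
qed

lemma integrable_bounded:
  fixes f :: "real \<Rightarrow> 'b::{banach, second_countable_topology}"
  assumes [measurable]: "f \<in> borel_measurable borel"
    and "\<And>x. \<bar>x\<bar> < R \<Longrightarrow> norm (f x) \<le> B"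
  shows "integrable M f"
proof (rule integrable_const_bound[where B = B])
  show "AE x in M. norm (f x) \<le> B" using bounded by eventually_elim (rule assms(2))
qed simp

lemma prob_symmetric_cell:
  assumes "0 < d"
  shows "prob {x. real k * d \<le> \<bar>x\<bar> \<and> \<bar>x\<bar> < real (Suc k) * d} = 2 * cell d k"
proof -
  let ?A = "{real k * d..<real (Suc k) * d}"
  have kd: "0 \<le> real k * d" using assms by simp
  have "{x. real k * d \<le> \<bar>x\<bar> \<and> \<bar>x\<bar> < real (Suc k) * d} = ?A \<union> uminus -` ?A"
    using kd by (auto simp: abs_if split: if_splits)
  then have "prob {x. real k * d \<le> \<bar>x\<bar> \<and> \<bar>x\<bar> < real (Suc k) * d} = prob (?A \<union> uminus -` ?A)"
    by simp
  \<comment> \<open>For k = 0 the two halves share the point 0, so they are disjoint only almost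
    everywhere.\<close>
  also have "\<dots> = prob ?A + prob (uminus -` ?A)"
  proof (rule measure_Un_AE)
    have "AE x in M. x \<notin> {0}" using nonatomic[of 0] by (subst prob_eq_0[symmetric]) auto
    then show "AE x in M. x \<notin> ?A \<or> x \<notin> uminus -` ?A"
      by eventually_elim (use kd in auto)
  qed (auto simp: fmeasurable_eq_sets)
  finally show ?thesis using symmetric[of ?A] by (simp add: cell_def)
qed

text \<open>On each grid interval the mean value theorem writes the increment of \<open>F\<close> as
  d * f z, and the Lipschitz bound compares f z with the left endpoint value, at a cost of K
  d^2.\<close>

lemma Riemann_sum_bound:
  fixes f F :: "real \<Rightarrow> real"
  assumes d: "0 < d" and n: "real n * d \<le> R"
    and lip: "\<And>x y. 0 \<le> x \<Longrightarrow> x \<le> R \<Longrightarrow> 0 \<le> y \<Longrightarrow> y \<le> R \<Longrightarrow> \<bar>f x - f y\<bar> \<le> K * \<bar>x - y\<bar>"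
    and deriv: "\<And>x. (F has_real_derivative f x) (at x)"
    and "0 \<le> K"
  shows "\<bar>d * (\<Sum>k<n. f (real k * d)) - (F (real n * d) - F 0)\<bar> \<le> real n * (K * d\<^sup>2)"
  using n
proof (induction n)
  case (Suc n)
  have "real n * d < real (Suc n) * d" using d by simp
  from MVT2[OF this deriv] obtain z where z: "real n * d < z" "z < real (Suc n) * d"
    and "F (real (Suc n) * d) - F (real n * d) = (real (Suc n) * d - real n * d) * f z" by blast
  then have eq: "F (real (Suc n) * d) - F (real n * d) = d * f z" by (simp add: algebra_simps)
  have nd: "0 \<le> real n * d" using d by simp
  have "\<bar>f (real n * d) - f z\<bar> \<le> K * \<bar>real n * d - z\<bar>"
    using z nd Suc.prems by (intro lip) linarith+
  also have "\<dots> \<le> K * d"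
    using z by (intro mult_left_mono \<open>0 \<le> K\<close>) (simp add: algebra_simps)
  finally have "\<bar>d * (f (real n * d) - f z)\<bar> \<le> K * d\<^sup>2"
    using d by (simp add: abs_mult power2_eq_square mult_ac)
  moreover have "\<bar>d * (\<Sum>k<n. f (real k * d)) - (F (real n * d) - F 0)\<bar> \<le> real n * (K * d\<^sup>2)"
    using Suc.prems d by (intro Suc.IH) (simp add: algebra_simps)
  ultimately show ?case using eq by (simp add: algebra_simps)
qed simp

text \<open>The mesh error 2 K d has two equal sources: replacing \<open>f\<close> by its value at
  the inner end of each cell, and replacing the primitive by Riemann sums in the partial sum bound.
  In the Abel bound, \<alpha> / d meets the first cell and \<beta> meets the total mass 1/2 of the
  cells.\<close>

lemma integral_even_le_step:
  fixes f F :: "real \<Rightarrow> real"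
  assumes [measurable]: "f \<in> borel_measurable borel"
    and even: "\<And>x. f (- x) = f x"
    and lip: "\<And>x y. 0 \<le> x \<Longrightarrow> x \<le> R \<Longrightarrow> 0 \<le> y \<Longrightarrow> y \<le> R \<Longrightarrow> \<bar>f x - f y\<bar> \<le> K * \<bar>x - y\<bar>"
    and K: "0 \<le> K"
    and deriv: "\<And>x. (F has_real_derivative f x) (at x)"
    and bound: "\<And>x. 0 \<le> x \<Longrightarrow> \<bar>F x - F 0\<bar> \<le> \<alpha> + \<beta> * x"
    and "0 \<le> \<alpha>"
    and d: "0 < d" and n: "real n * d = R"
  shows "\<bar>\<integral>x. f x \<partial>M\<bar> \<le> 2 * \<alpha> * (cell d 0 / d) + \<beta> + 2 * (K * d)"
proof -
  let ?I = "\<lambda>k. {x. real k * d \<le> \<bar>x\<bar> \<and> \<bar>x\<bar> < real (Suc k) * d}"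
  let ?g = "\<lambda>x. \<Sum>k<n. f (real k * d) * indicator (?I k) x"
  have close: "\<bar>f x - ?g x\<bar> \<le> K * d" if "\<bar>x\<bar> < R" for x
  proof -
    obtain m :: nat where m': "real m * d \<le> \<bar>x\<bar>" "\<bar>x\<bar> < (real m + 1) * d"
      using ex_nat_multiple_interval[OF d abs_ge_zero] by blast
    have "real m * d < real n * d" using m'(1) that n by linarith
    then have "m < n" using d by simp
    have only: "x \<in> ?I k \<longleftrightarrow> k = m" for k
    proof
      assume "x \<in> ?I k"
      then have "real k * d < (real m + 1) * d" "real m * d < (real k + 1) * d"
        using m' by (auto simp: algebra_simps)
      then have "real k < real m + 1" "real m < real k + 1" using d by simp_all
      then show "k = m" by linarith
    qed (use m' in \<open>auto simp: algebra_simps\<close>)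
    have "?g x = (\<Sum>k<n. if k = m then f (real m * d) else 0)"
      by (intro sum.cong refl) (use only in \<open>auto simp: indicator_def\<close>)
    then have "?g x = f (real m * d)" using \<open>m < n\<close> by simp
    moreover have "f x = f \<bar>x\<bar>" using even by (simp add: abs_if)
    moreover have "\<bar>f \<bar>x\<bar> - f (real m * d)\<bar> \<le> K * \<bar>\<bar>x\<bar> - real m * d\<bar>"
      using m' that d by (intro lip) auto
    moreover have "K * \<bar>\<bar>x\<bar> - real m * d\<bar> \<le> K * d"
      using m' by (intro mult_left_mono K) (auto simp: algebra_simps)
    ultimately show ?thesis by simp
  qed
  have int_f: "integrable M f"
  proof (rule integrable_bounded[where B = "\<bar>f 0\<bar> + K * R"])
    fix x assume x: "\<bar>x\<bar> < R"
    have "\<bar>f \<bar>x\<bar> - f 0\<bar> \<le> K * \<bar>\<bar>x\<bar> - 0\<bar>" using x by (intro lip) auto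
    also have "\<dots> \<le> K * R" using x by (intro mult_left_mono K) auto
    finally have "\<bar>f \<bar>x\<bar>\<bar> \<le> \<bar>f 0\<bar> + K * R" by linarith
    moreover have "f x = f \<bar>x\<bar>" using even by (simp add: abs_if)
    ultimately show "norm (f x) \<le> \<bar>f 0\<bar> + K * R" by simp
  qed simp
  have int_g: "integrable M ?g"
    by (intro Bochner_Integration.integrable_sum integrable_mult_right integrable_real_indicator)
      (auto simp: emeasure_eq_measure)
  have "\<bar>(\<integral>x. f x \<partial>M) - (\<integral>x. ?g x \<partial>M)\<bar> = \<bar>\<integral>x. f x - ?g x \<partial>M\<bar>"
    by (simp only: Bochner_Integration.integral_diff[OF int_f int_g])
  also have "\<dots> \<le> (\<integral>x. \<bar>f x - ?g x\<bar> \<partial>M)" by (rule integral_abs_bound)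
  also have "\<dots> \<le> (\<integral>x. K * d \<partial>M)"
  proof (rule integral_mono_AE)
    show "AE x in M. \<bar>f x - ?g x\<bar> \<le> K * d" using bounded by eventually_elim (rule close)
    show "integrable M (\<lambda>x. \<bar>f x - ?g x\<bar>)"
      by (intro integrable_abs Bochner_Integration.integrable_diff int_f int_g)
  qed simp
  finally have approx: "\<bar>(\<integral>x. f x \<partial>M) - (\<integral>x. ?g x \<partial>M)\<bar> \<le> K * d"
    using prob_space by simp
  have g: "(\<integral>x. ?g x \<partial>M) = 2 * (\<Sum>k<n. cell d k * f (real k * d))"
    by (subst Bochner_Integration.integral_sum)
      (auto intro!: integrable_real_indicator sum.cong
        simp: emeasure_eq_measure prob_symmetric_cell[OF d] sum_distrib_left simp del: of_nat_Suc)
  have partial: "\<bar>\<Sum>j<k. f (real j * d)\<bar> \<le> \<alpha> / d + (\<beta> + K * d) * real k" if "k \<le> n" for k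
  proof -
    have "real k * d \<le> R" using that n d by (metis mult_right_mono of_nat_le_iff less_imp_le)
    then have "\<bar>d * (\<Sum>j<k. f (real j * d)) - (F (real k * d) - F 0)\<bar> \<le> real k * (K * d\<^sup>2)"
      by (intro Riemann_sum_bound d lip deriv K) auto
    moreover have "\<bar>F (real k * d) - F 0\<bar> \<le> \<alpha> + \<beta> * (real k * d)" using d by (intro bound) auto
    ultimately have "\<bar>d * (\<Sum>j<k. f (real j * d))\<bar> \<le> \<alpha> + \<beta> * (real k * d) + real k * (K * d\<^sup>2)"
      by linarith
    then show ?thesis using d by (simp add: abs_mult field_simps power2_eq_square)
  qed
  have "\<bar>(\<Sum>k<n. cell d k * f (real k * d)) - cell d n * (\<Sum>k<n. f (real k * d))\<bar>
      \<le> \<alpha> / d * (cell d 0 - cell d n) + (\<beta> + K * d) * ((\<Sum>k<n. cell d k) - real n * cell d n)"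
    by (rule abel_summation_bound[where p = "cell d" and f = "\<lambda>k. f (real k * d)"])
      (use cell_nonneg cell_decreasing[OF d] partial \<open>0 \<le> \<alpha>\<close> d in auto)
  \<comment> \<open>The grid ends at \<open>R\<close>, so the cell with index n is null and the
    boundary terms of the Abel bound disappear.\<close>
  moreover have "tail d n = 0" "tail d (Suc n) = 0"
    using n d by (auto intro!: tail_eq_0 simp: algebra_simps)
  moreover have "cell d n = 0" using tail_Suc[OF d, of n] calculation(2,3) by simp
  ultimately have sum: "\<bar>\<Sum>k<n. cell d k * f (real k * d)\<bar> \<le> \<alpha> / d * cell d 0 + (\<beta> + K * d) / 2"
    by (simp add: sum_cell[OF d])
  have "\<bar>\<integral>x. f x \<partial>M\<bar> \<le> 2 * \<bar>\<Sum>k<n. cell d k * f (real k * d)\<bar> + K * d"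
    using approx unfolding g by linarith
  also have "\<dots> \<le> 2 * (\<alpha> / d * cell d 0 + (\<beta> + K * d) / 2) + K * d"
    by (intro add_right_mono mult_left_mono sum) simp
  also have "\<dots> = 2 * \<alpha> * (cell d 0 / d) + \<beta> + 2 * (K * d)"
    using d by (simp add: field_simps)
  finally show ?thesis .
qed

proposition integral_even_le:
  fixes f F :: "real \<Rightarrow> real"
  assumes "f \<in> borel_measurable borel"
    and "\<And>x. f (- x) = f x"
    and "\<And>x y. 0 \<le> x \<Longrightarrow> x \<le> R \<Longrightarrow> 0 \<le> y \<Longrightarrow> y \<le> R \<Longrightarrow> \<bar>f x - f y\<bar> \<le> K * \<bar>x - y\<bar>"
    and K: "0 \<le> K"
    and "\<And>x. (F has_real_derivative f x) (at x)"
    and "\<And>x. 0 \<le> x \<Longrightarrow> \<bar>F x - F 0\<bar> \<le> \<alpha> + \<beta> * x"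
    and \<alpha>: "0 \<le> \<alpha>"
    and L: "0 < L" "L\<^sup>2 \<le> (\<integral>x. x\<^sup>2 \<partial>M)"
  shows "\<bar>\<integral>x. f x \<partial>M\<bar> \<le> 2 * \<alpha> / L + \<beta>"
proof (rule field_le_epsilon)
  fix e :: real assume "0 < e"
  obtain n where n: "2 * K * R / e < real n" using reals_Archimedean2 by blast
  moreover have "0 \<le> 2 * K * R / e" using K R_pos \<open>0 < e\<close> by simp
  ultimately have "0 < real n" by linarith
  \<comment> \<open>The mesh divides \<open>R\<close> exactly, and n is large enough for the error 2
    K d to be at most e.\<close>
  let ?d = "R / real n"
  have d: "0 < ?d" using R_pos \<open>0 < real n\<close> by simp
  have "\<bar>\<integral>x. f x \<partial>M\<bar> \<le> 2 * \<alpha> * (cell ?d 0 / ?d) + \<beta> + 2 * (K * ?d)"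
    by (rule integral_even_le_step[OF assms(1-7) d, of n]) (use \<open>0 < real n\<close> in auto)
  also have "\<dots> \<le> 2 * \<alpha> * (1 / L) + \<beta> + e"
  proof (intro add_mono order_refl)
    show "2 * \<alpha> * (cell ?d 0 / ?d) \<le> 2 * \<alpha> * (1 / L)"
      using \<alpha> by (intro mult_left_mono cell_0_le[OF d L]) auto
    show "2 * (K * ?d) \<le> e" using n \<open>0 < real n\<close> \<open>0 < e\<close> by (simp add: field_simps)
  qed
  finally show "\<bar>\<integral>x. f x \<partial>M\<bar> \<le> 2 * \<alpha> / L + \<beta> + e" by simp
qed

end

subsection \<open>Marginals of symmetric convex bodies\<close>

locale unit_volume_symmetric_body =
  fixes G :: "'a::euclidean_space set"
  assumes body: "convex_symmetric_body G" and volume: "measure lebesgue G = 1"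
begin

text \<open>No normalizing factor appears because \<open>G\<close> has volume 1.\<close>

definition unif :: "'a measure" where
  "unif = restrict_space lborel G"

definition marginal :: "'a \<Rightarrow> real measure" where
  "marginal \<xi> = distr unif borel (\<lambda>x. x \<bullet> \<xi>)"

lemma convex_G: "convex G" and compact_G: "compact G"
  and uminus_mem: "x \<in> G \<Longrightarrow> - x \<in> G"
  using body by (auto simp: convex_symmetric_body_def compact_eq_bounded_closed)

lemma borel_G [measurable, simp]: "G \<in> sets borel"
  using compact_G by (simp add: borel_compact)

lemma emeasure_G: "emeasure lborel G = 1"
proof -
  have *: "measure lborel G = 1" using volume by (simp add: measure_completion)
  \<comment> \<open>\<open>measure\<close> assigns 0 to sets of infinite measure, so the value 1
    rules that out.\<close>
  then have "emeasure lborel G \<noteq> top" by (auto simp: measure_def)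
  then show ?thesis using * by (simp add: emeasure_eq_ennreal_measure)
qed

lemma space_unif [simp]: "space unif = G"
  by (simp add: unif_def space_restrict_space)

lemma measurable_inner_unif [measurable]: "(\<lambda>x. x \<bullet> \<xi>) \<in> borel_measurable unif"
  unfolding unif_def by (rule measurable_restrict_space1) simp

sublocale unif: prob_space unif
  by standard (simp add: unif_def emeasure_restrict_space emeasure_G space_restrict_space)

lemma integrable_unif:
  fixes f :: "'a \<Rightarrow> 'b::{banach, second_countable_topology}"
  assumes "continuous_on G f"
  shows "integrable unif f"
  unfolding unif_def using borel_integrable_compact[OF compact_G assms]
  by (subst integrable_restrict_space) auto

lemma integral_eq_unif:
  fixes f :: "'a \<Rightarrow> 'b::euclidean_space"
  assumes "continuous_on G f"
  shows "integral G f = (\<integral>x. f x \<partial>unif)"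
proof -
  have "set_integrable lborel G f"
    unfolding set_integrable_def by (rule borel_integrable_compact[OF compact_G assms])
  from set_borel_integral_eq_integral(2)[OF this] show ?thesis
    by (simp add: unif_def integral_restrict_space set_lebesgue_integral_def)
qed

lemma norm_integral_unif_le:
  fixes f :: "'a \<Rightarrow> 'b::{banach, second_countable_topology}"
  assumes "continuous_on G f" and le: "\<And>x. x \<in> G \<Longrightarrow> norm (f x) \<le> c"
  shows "norm (\<integral>x. f x \<partial>unif) \<le> c"
proof -
  have "norm (\<integral>x. f x \<partial>unif) \<le> (\<integral>x. norm (f x) \<partial>unif)" by (rule integral_norm_bound)
  also have "\<dots> \<le> (\<integral>x. c \<partial>unif)"
    using le by (intro integral_mono integrable_norm integrable_unif assms) auto
  finally show ?thesis using unif.prob_space by simp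
qed

lemma measure_marginal:
  assumes "A \<in> sets borel"
  shows "measure (marginal \<xi>) A = measure lborel {x \<in> G. x \<bullet> \<xi> \<in> A}"
proof -
  have "measure (marginal \<xi>) A = measure unif ((\<lambda>x. x \<bullet> \<xi>) -` A \<inter> G)"
    unfolding marginal_def by (simp add: measure_distr assms measurable_inner_unif)
  also have "\<dots> = measure lborel ((\<lambda>x. x \<bullet> \<xi>) -` A \<inter> G)"
    unfolding unif_def by (rule measure_restrict_space) simp_all
  also have "(\<lambda>x. x \<bullet> \<xi>) -` A \<inter> G = {x \<in> G. x \<bullet> \<xi> \<in> A}" by auto
  finally show ?thesis .
qed

lemma integral_marginal:
  fixes f :: "real \<Rightarrow> 'b::{banach, second_countable_topology}"
  assumes [measurable]: "f \<in> borel_measurable borel"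
  shows "(\<integral>t. f t \<partial>marginal \<xi>) = (\<integral>x. f (x \<bullet> \<xi>) \<partial>unif)"
  unfolding marginal_def by (rule integral_distr[OF measurable_inner_unif assms])

lemma emeasure_slice:
  assumes [measurable]: "A \<in> sets borel"
  shows "emeasure lborel {x \<in> G. x \<bullet> \<xi> \<in> A} = ennreal (measure lborel {x \<in> G. x \<bullet> \<xi> \<in> A})"
proof (rule emeasure_eq_ennreal_measure)
  have "emeasure lborel {x \<in> G. x \<bullet> \<xi> \<in> A} \<le> emeasure lborel G"
    by (rule emeasure_mono) auto
  then show "emeasure lborel {x \<in> G. x \<bullet> \<xi> \<in> A} \<noteq> top" by (auto simp: emeasure_G top_unique)
qed

lemma measure_lborel_uminus:
  fixes S :: "'a set"
  assumes [measurable]: "S \<in> sets borel"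
  shows "measure lborel (uminus ` S) = measure lborel S"
proof -
  have "uminus ` S = uminus -` S" by force
  then have [measurable]: "uminus ` S \<in> sets borel"
    using measurable_sets[of uminus borel borel S] by simp
  have "measure lebesgue (uminus ` S) = measure lebesgue S"
    using measure_lebesgue_affine[of "-1" 0 S] by simp
  then show ?thesis by (simp add: measure_completion)
qed

text \<open>Each axiom is a property of the slices of \<open>G\<close>. For \<open>midpoint\<close>,
  convexity keeps the average of points from two slices in \<open>G\<close>, and linearity of the
  inner product places it in the averaged slice; the inequality in the full space thus descends to
  the line. Points are null since their slices lie in hyperplanes.\<close>

lemma marginal_distribution:
  assumes "\<xi> \<noteq> 0"
  obtains R where "symmetric_log_concave_distribution (marginal \<xi>) R"
proof -
  let ?S = "\<lambda>A. {x \<in> G. x \<bullet> \<xi> \<in> A}"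
  have S [measurable]: "?S A \<in> sets borel" if [measurable]: "A \<in> sets borel" for A by measurable
  obtain B where B: "\<And>x. x \<in> G \<Longrightarrow> norm x \<le> B"
    using compact_G by (meson bounded_iff compact_imp_bounded)
  \<comment> \<open>The summand 1 makes the bound on |x . \<xi>| strict and \<open>R\<close>
    positive.\<close>
  define R where "R = \<bar>B\<bar> * norm \<xi> + 1"
  have "symmetric_log_concave_distribution (marginal \<xi>) R"
  proof (intro symmetric_log_concave_distribution.intro real_distribution.intro
      real_distribution_axioms.intro symmetric_log_concave_distribution_axioms.intro)
    show "prob_space (marginal \<xi>)"
      unfolding marginal_def by (rule unif.prob_space_distr[OF measurable_inner_unif])
    show "sets (marginal \<xi>) = sets borel" by (simp add: marginal_def)
    show "0 < R" by (simp add: R_def add_nonneg_pos)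
    show "AE t in marginal \<xi>. \<bar>t\<bar> < R"
    proof -
      have "\<bar>x \<bullet> \<xi>\<bar> < R" if "x \<in> G" for x
      proof -
        have "\<bar>x \<bullet> \<xi>\<bar> \<le> norm x * norm \<xi>" by (rule Cauchy_Schwarz_ineq2)
        also have "\<dots> \<le> \<bar>B\<bar> * norm \<xi>" using B[OF that] by (intro mult_right_mono) auto
        finally show ?thesis by (simp add: R_def)
      qed
      then show ?thesis unfolding marginal_def by (subst AE_distr_iff[OF measurable_inner_unif]) auto
    qed
    show "measure (marginal \<xi>) {t} = 0" for t
    proof -
      have "negligible {x. \<xi> \<bullet> x = t}" using assms by (intro negligible_hyperplane) simp
      then have "negligible (?S {t})" by (rule negligible_subset) (auto simp: inner_commute)
      then have "measure lebesgue (?S {t}) = 0" by (rule negligible_imp_measure0)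
      then show ?thesis by (simp add: measure_marginal measure_completion)
    qed
    show "measure (marginal \<xi>) (uminus -` A) = measure (marginal \<xi>) A" if A: "A \<in> sets borel" for A
    proof -
      have "?S (uminus -` A) = uminus ` ?S A"
        using uminus_mem by (force simp: image_iff intro: exI[of _ "- x" for x])
      then show ?thesis using A S[OF A] by (simp add: measure_marginal measure_lborel_uminus)
    qed
    show "measure (marginal \<xi>) A * measure (marginal \<xi>) B \<le> (measure (marginal \<xi>) C)\<^sup>2"
      if [measurable]: "A \<in> sets borel" "B \<in> sets borel" "C \<in> sets borel"
        and mid: "\<And>s t. s \<in> A \<Longrightarrow> t \<in> B \<Longrightarrow> (s + t) / 2 \<in> C" for A B C
    proof -
      have "emeasure lborel (?S A) * emeasure lborel (?S B) \<le> (emeasure lborel (?S C))\<^sup>2"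
      proof (rule brunn_minkowski_midpoint)
        fix x y assume xy: "x \<in> ?S A" "y \<in> ?S B"
        then have "(1 / 2) *\<^sub>R x + (1 / 2) *\<^sub>R y \<in> G" by (intro convexD convex_G) auto
        moreover have "((1 / 2) *\<^sub>R (x + y)) \<bullet> \<xi> \<in> C"
          using mid[of "x \<bullet> \<xi>" "y \<bullet> \<xi>"] xy by (simp add: inner_add_left)
        ultimately show "(1 / 2) *\<^sub>R (x + y) \<in> ?S C" by (simp add: scaleR_add_right)
      qed auto
      then have "measure lborel (?S A) * measure lborel (?S B) \<le> (measure lborel (?S C))\<^sup>2"
        using that(1-3)
        by (simp add: emeasure_slice ennreal_mult'[symmetric] ennreal_power ennreal_le_iff)
      then show ?thesis using that(1-3) by (simp add: measure_marginal)
    qed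
  qed
  then show ?thesis by (rule that)
qed

section \<open>The Fourier transform of the body and its derivative\<close>

lemma mG_eq: "mG G \<xi> = (\<integral>x. iexp (2 * pi * (x \<bullet> \<xi>)) \<partial>unif)"
  unfolding mG_def
  by (subst integral_eq_unif) (auto intro!: continuous_intros simp: mult_ac)

text \<open>Differentiation under the integral by an explicit remainder: |e^(is) - 1 - is| \<le> s^2
  / 2 with s = 2 pi x . (\<eta> - \<xi>). Since \<open>G\<close> is bounded, |s| \<le> 2 pi B
  |\<eta> - \<xi>| uniformly in x, which is where the constant \<open>c\<close> comes from.\<close>

lemma mG_has_derivative:
  "(mG G has_derivative
     (\<lambda>\<eta>. \<integral>x. \<i> * complex_of_real (2 * pi * (x \<bullet> \<eta>)) * iexp (2 * pi * (x \<bullet> \<xi>)) \<partial>unif)) (at \<xi>)"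
  (is "(_ has_derivative ?D) _")
proof -
  obtain B where B: "\<And>x. x \<in> G \<Longrightarrow> norm x \<le> B"
    using compact_G by (meson bounded_iff compact_imp_bounded)
  have cont: "continuous_on G (\<lambda>x. \<i> * complex_of_real (2 * pi * (x \<bullet> \<eta>)) * iexp (2 * pi * (x \<bullet> \<xi>)))"
    for \<eta> by (intro continuous_intros)
  have cont_e: "continuous_on G (\<lambda>x. iexp (2 * pi * (x \<bullet> \<eta>)))" for \<eta> :: 'a
    by (intro continuous_intros)
  note int = integrable_unif[OF cont] integrable_unif[OF cont_e]
  have "linear ?D"
  proof
    fix \<eta> \<zeta>
    have "?D (\<eta> + \<zeta>) = (\<integral>x. \<i> * complex_of_real (2 * pi * (x \<bullet> \<eta>)) * iexp (2 * pi * (x \<bullet> \<xi>))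
        + \<i> * complex_of_real (2 * pi * (x \<bullet> \<zeta>)) * iexp (2 * pi * (x \<bullet> \<xi>)) \<partial>unif)"
      by (simp add: inner_add_right algebra_simps)
    also have "\<dots> = ?D \<eta> + ?D \<zeta>" by (rule Bochner_Integration.integral_add[OF int(1) int(1)])
    finally show "?D (\<eta> + \<zeta>) = ?D \<eta> + ?D \<zeta>" .
  next
    fix r \<eta>
    have "?D (r *\<^sub>R \<eta>) = (\<integral>x. r *\<^sub>R (\<i> * complex_of_real (2 * pi * (x \<bullet> \<eta>)) * iexp (2 * pi * (x \<bullet> \<xi>))) \<partial>unif)"
      by (simp add: scaleR_conv_of_real mult_ac)
    also have "\<dots> = r *\<^sub>R ?D \<eta>" by (rule integral_scaleR_right)
    finally show "?D (r *\<^sub>R \<eta>) = r *\<^sub>R ?D \<eta>" .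
  qed
  then have bl: "bounded_linear ?D" by (simp add: linear_conv_bounded_linear)
  define c where "c = (2 * pi * B)\<^sup>2 / 2"
  have est: "norm (mG G \<eta> - mG G \<xi> - ?D (\<eta> - \<xi>)) \<le> c * (norm (\<eta> - \<xi>))\<^sup>2" for \<eta>
  proof -
    let ?s = "\<lambda>x. 2 * pi * (x \<bullet> (\<eta> - \<xi>))"
    let ?f = "\<lambda>x. iexp (2 * pi * (x \<bullet> \<eta>)) - iexp (2 * pi * (x \<bullet> \<xi>))
        - \<i> * complex_of_real (?s x) * iexp (2 * pi * (x \<bullet> \<xi>))"
    have "mG G \<eta> - mG G \<xi> - ?D (\<eta> - \<xi>) = (\<integral>x. ?f x \<partial>unif)"
      unfolding mG_eq
      by (simp only: Bochner_Integration.integral_diff[OF int(2) int(2)]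
        Bochner_Integration.integral_diff[OF Bochner_Integration.integrable_diff[OF int(2) int(2)] int(1)])
    also have "norm \<dots> \<le> c * (norm (\<eta> - \<xi>))\<^sup>2"
    proof (rule norm_integral_unif_le)
      show "continuous_on G ?f" by (intro continuous_intros)
      fix x assume x: "x \<in> G"
      have "2 * pi * (x \<bullet> \<eta>) = 2 * pi * (x \<bullet> \<xi>) + ?s x" by (simp add: inner_diff_right algebra_simps)
      then have "iexp (2 * pi * (x \<bullet> \<eta>)) = iexp (2 * pi * (x \<bullet> \<xi>)) * iexp (?s x)"
        by (simp only: of_real_add distrib_left exp_add)
      then have "?f x = iexp (2 * pi * (x \<bullet> \<xi>)) * (iexp (?s x) - (1 + \<i> * complex_of_real (?s x)))"
        by (simp only: algebra_simps mult_1_left mult_1_right)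
      then have "norm (?f x) = norm (iexp (?s x) - (1 + \<i> * complex_of_real (?s x)))"
        by (simp only: norm_mult norm_exp_i_times mult_1_left)
      also have "\<dots> \<le> (?s x)\<^sup>2 / 2" using iexp_approx1[of "?s x" 1] by (simp add: power2_eq_square)
      also have "\<dots> \<le> c * (norm (\<eta> - \<xi>))\<^sup>2"
      proof -
        have "\<bar>?s x\<bar> \<le> 2 * pi * (norm x * norm (\<eta> - \<xi>))"
          using Cauchy_Schwarz_ineq2[of x "\<eta> - \<xi>"] by (simp add: abs_mult)
        also have "\<dots> \<le> 2 * pi * (B * norm (\<eta> - \<xi>))"
          using B[OF x] by (intro mult_left_mono mult_right_mono) auto
        finally have "\<bar>?s x\<bar>\<^sup>2 \<le> (2 * pi * (B * norm (\<eta> - \<xi>)))\<^sup>2" by (intro power_mono) auto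
        then show ?thesis by (simp add: c_def power_mult_distrib mult_ac)
      qed
      finally show "norm (?f x) \<le> c * (norm (\<eta> - \<xi>))\<^sup>2" .
    qed
    finally show ?thesis .
  qed
  show ?thesis
  proof (rule has_derivativeI_sandwich[of 1])
    show "((\<lambda>\<eta>. c * norm (\<eta> - \<xi>)) \<longlongrightarrow> 0) (at \<xi>)" by (rule tendsto_eq_intros | simp)+
    fix \<eta> assume "\<eta> \<noteq> \<xi>"
    then show "norm (mG G \<eta> - mG G \<xi> - ?D (\<eta> - \<xi>)) / norm (\<eta> - \<xi>) \<le> c * norm (\<eta> - \<xi>)"
      using est[of \<eta>] by (simp add: divide_le_eq power2_eq_square mult_ac)
  qed (use bl in auto)
qed

lemma complex_integral_eqI:
  fixes f :: "'a \<Rightarrow> complex"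
  assumes "continuous_on G f"
  shows "(\<integral>x. f x \<partial>unif) = Complex (\<integral>x. Re (f x) \<partial>unif) (\<integral>x. Im (f x) \<partial>unif)"
  using integrable_unif[OF assms] by (simp add: complex_eq_iff)

end

section \<open>The three estimates in a fixed direction\<close>

locale isotropic_body = unit_volume_symmetric_body G
  for G :: "'a::euclidean_space set" +
  fixes L :: real and \<xi> :: 'a
  assumes L_pos: "0 < L" and nonzero: "\<xi> \<noteq> 0"
    and second_moment: "integral G (\<lambda>x. (x \<bullet> \<xi>)\<^sup>2) = L\<^sup>2 * (norm \<xi>)\<^sup>2"
begin

lemma scale_pos: "0 < L * norm \<xi>"
  using L_pos nonzero by simp

lemma integral_marginal_square: "(\<integral>t. t\<^sup>2 \<partial>marginal \<xi>) = (L * norm \<xi>)\<^sup>2"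
  using second_moment
  by (simp add: integral_marginal integral_eq_unif continuous_intros power_mult_distrib)

lemma norm_mG_le: "norm (mG G \<xi>) \<le> 1 / (pi * (L * norm \<xi>))"
proof -
  obtain R where "symmetric_log_concave_distribution (marginal \<xi>) R"
    using marginal_distribution[OF nonzero] .
  then interpret nu: symmetric_log_concave_distribution "marginal \<xi>" R .
  have "mG G \<xi> = Complex (\<integral>t. cos (2 * pi * t) \<partial>marginal \<xi>) (\<integral>t. sin (2 * pi * t) \<partial>marginal \<xi>)"
    unfolding mG_eq
    by (subst complex_integral_eqI)
      (auto intro!: continuous_intros simp: integral_marginal Re_exp Im_exp)
  moreover have "(\<integral>t. sin (2 * pi * t) \<partial>marginal \<xi>) = 0" by (rule nu.integral_odd) auto
  ultimately have "norm (mG G \<xi>) = \<bar>\<integral>t. cos (2 * pi * t) \<partial>marginal \<xi>\<bar>"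
    by (simp add: complex_norm)
  also have "\<dots> \<le> 2 * (1 / (2 * pi)) / (L * norm \<xi>) + 0"
  \<comment> \<open>The primitive of the cosine is bounded by 1 / (2 pi) and does not grow, so
    \<alpha> = 1 / (2 pi) and \<beta> = 0.\<close>
  proof (rule nu.integral_even_le[where K = "2 * pi" and F = "\<lambda>t. sin (2 * pi * t) / (2 * pi)"])
    show "\<bar>cos (2 * pi * x) - cos (2 * pi * y)\<bar> \<le> 2 * pi * \<bar>x - y\<bar>" for x y
    proof -
      have "norm (cos (2 * pi * x) - cos (2 * pi * y)) \<le> 2 * pi * norm (x - y)"
        by (rule field_differentiable_bound[where S = UNIV and f' = "\<lambda>t. - (2 * pi * sin (2 * pi * t))"])
          (auto intro!: derivative_eq_intros simp: abs_mult)
      then show ?thesis by simp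
    qed
    show "((\<lambda>t. sin (2 * pi * t) / (2 * pi)) has_real_derivative cos (2 * pi * x)) (at x)" for x
      by (auto intro!: derivative_eq_intros)
    show "\<bar>sin (2 * pi * x) / (2 * pi) - sin (2 * pi * 0) / (2 * pi)\<bar> \<le> 1 / (2 * pi) + 0 * x" for x
      by (simp add: divide_right_mono)
    show "(L * norm \<xi>)\<^sup>2 \<le> (\<integral>x. x\<^sup>2 \<partial>marginal \<xi>)" by (simp add: integral_marginal_square)
  qed (use scale_pos in auto)
  finally show ?thesis by simp
qed

lemma norm_mG_minus_1_le: "norm (mG G \<xi> - 1) \<le> 2 * pi * (L * norm \<xi>)"
proof -
  let ?l = "L * norm \<xi>" and ?e = "\<lambda>x. iexp (2 * pi * (x \<bullet> \<xi>)) - 1"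
  have cont: "continuous_on G ?e" by (intro continuous_intros)
  have "mG G \<xi> - 1 = (\<integral>x. ?e x \<partial>unif)"
    unfolding mG_eq using unif.prob_space
    by (subst Bochner_Integration.integral_diff) (auto intro!: integrable_unif continuous_intros)
  also have "norm \<dots> \<le> (\<integral>x. norm (?e x) \<partial>unif)" by (rule integral_norm_bound)
  also have "\<dots> \<le> (\<integral>x. pi * ((x \<bullet> \<xi>)\<^sup>2 / ?l + ?l) \<partial>unif)"
  proof (rule integral_mono)
    show "integrable unif (\<lambda>x. norm (?e x))" by (intro integrable_norm integrable_unif cont)
    show "integrable unif (\<lambda>x. pi * ((x \<bullet> \<xi>)\<^sup>2 / ?l + ?l))"
      by (intro integrable_unif continuous_intros) (use scale_pos in auto)
    fix x
    have "norm (?e x) \<le> 2 * pi * \<bar>x \<bullet> \<xi>\<bar>"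
      using iexp_approx1[of "2 * pi * (x \<bullet> \<xi>)" 0] by (simp add: abs_mult)
    \<comment> \<open>Completing the square takes the place of Cauchy-Schwarz. With weight l = L
      |\<xi>| both terms on the right have expectation l.\<close>
    also have "2 * \<bar>x \<bullet> \<xi>\<bar> \<le> (x \<bullet> \<xi>)\<^sup>2 / ?l + ?l"
    proof -
      have "(y - l)\<^sup>2 / l = y\<^sup>2 / l + l - 2 * y" if "0 < l" for y l :: real
        using that by (simp add: field_simps power2_eq_square)
      from this[OF scale_pos, of "\<bar>x \<bullet> \<xi>\<bar>"]
      have "(\<bar>x \<bullet> \<xi>\<bar> - ?l)\<^sup>2 / ?l = (x \<bullet> \<xi>)\<^sup>2 / ?l + ?l - 2 * \<bar>x \<bullet> \<xi>\<bar>"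
        by simp
      moreover have "0 \<le> (\<bar>x \<bullet> \<xi>\<bar> - ?l)\<^sup>2 / ?l" using scale_pos by simp
      ultimately show ?thesis by linarith
    qed
    then have "2 * pi * \<bar>x \<bullet> \<xi>\<bar> \<le> pi * ((x \<bullet> \<xi>)\<^sup>2 / ?l + ?l)"
      using mult_left_mono[of "2 * \<bar>x \<bullet> \<xi>\<bar>" _ pi] by (simp add: mult_ac)
    finally show "norm (?e x) \<le> pi * ((x \<bullet> \<xi>)\<^sup>2 / ?l + ?l)" .
  qed
  also have "\<dots> = pi * ((\<integral>x. (x \<bullet> \<xi>)\<^sup>2 \<partial>unif) / ?l + ?l)"
    using unif.prob_space
    by (subst integral_mult_right_zero, subst Bochner_Integration.integral_add)
      (auto intro!: integrable_unif continuous_intros simp: less_imp_neq[OF L_pos, symmetric] nonzero)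
  also have "(\<integral>x. (x \<bullet> \<xi>)\<^sup>2 \<partial>unif) = ?l\<^sup>2"
    using integral_marginal_square by (simp add: integral_marginal)
  also have "pi * (?l\<^sup>2 / ?l + ?l) = 2 * pi * ?l" using scale_pos by (simp add: power2_eq_square)
  finally show ?thesis .
qed

text \<open>The imaginary part of the integrand is odd and drops out. The primitive of 2 pi t sin (2
  pi t) vanishes at 0 and grows at most like 2 t, so the whole bound comes from \<beta> = 2 and the
  scale L |\<xi>| cancels.\<close>

lemma norm_radial_derivative_le:
  "norm (\<integral>x. \<i> * complex_of_real (2 * pi * (x \<bullet> \<xi>)) * iexp (2 * pi * (x \<bullet> \<xi>)) \<partial>unif) \<le> 2"
  (is "norm ?I \<le> 2")
proof -
  obtain R where "symmetric_log_concave_distribution (marginal \<xi>) R"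
    using marginal_distribution[OF nonzero] .
  then interpret nu: symmetric_log_concave_distribution "marginal \<xi>" R .
  let ?f = "\<lambda>t. 2 * pi * t * sin (2 * pi * t)" and ?F = "\<lambda>t. sin (2 * pi * t) / (2 * pi) - t * cos (2 * pi * t)"
  have "?I = Complex (\<integral>t. - ?f t \<partial>marginal \<xi>) (\<integral>t. 2 * pi * t * cos (2 * pi * t) \<partial>marginal \<xi>)"
    by (subst complex_integral_eqI)
      (auto intro!: continuous_intros simp: integral_marginal Re_exp Im_exp)
  moreover have "(\<integral>t. 2 * pi * t * cos (2 * pi * t) \<partial>marginal \<xi>) = 0" by (rule nu.integral_odd) auto
  ultimately have "norm ?I = \<bar>\<integral>t. ?f t \<partial>marginal \<xi>\<bar>" by (simp add: complex_norm)
  also have "\<dots> \<le> 2 * 0 / (L * norm \<xi>) + 2"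
  \<comment> \<open>\<open>K\<close> bounds the derivative of \<open>?f\<close> on [0, R]. This
    derivative is unbounded on the half-line, hence the Lipschitz condition of the criterion is
    confined to [0, R].\<close>
  proof (rule nu.integral_even_le[where K = "2 * pi + (2 * pi)\<^sup>2 * R" and F = ?F])
    show "\<bar>?f x - ?f y\<bar> \<le> (2 * pi + (2 * pi)\<^sup>2 * R) * \<bar>x - y\<bar>"
      if "0 \<le> x" "x \<le> R" "0 \<le> y" "y \<le> R" for x y
    proof -
      have "norm (?f x - ?f y) \<le> (2 * pi + (2 * pi)\<^sup>2 * R) * norm (x - y)"
      proof (rule field_differentiable_bound[where S = "{0..R}"])
        show "(?f has_field_derivative 2 * pi * sin (2 * pi * t) + (2 * pi)\<^sup>2 * t * cos (2 * pi * t))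
            (at t within {0..R})" for t
          by (auto intro!: derivative_eq_intros simp: power2_eq_square)
        fix t assume t: "t \<in> {0..R}"
        have "\<bar>2 * pi * sin (2 * pi * t)\<bar> \<le> 2 * pi" by (simp add: abs_mult)
        moreover have "\<bar>(2 * pi)\<^sup>2 * t * cos (2 * pi * t)\<bar> \<le> (2 * pi)\<^sup>2 * R * 1"
          unfolding abs_mult using t by (intro mult_mono) auto
        ultimately show "norm (2 * pi * sin (2 * pi * t) + (2 * pi)\<^sup>2 * t * cos (2 * pi * t))
            \<le> 2 * pi + (2 * pi)\<^sup>2 * R" by simp
      qed (use that in auto)
      then show ?thesis by simp
    qed
    show "(?F has_real_derivative ?f x) (at x)" for x
      by (auto intro!: derivative_eq_intros)
    show "\<bar>?F x - ?F 0\<bar> \<le> 0 + 2 * x" if "0 \<le> x" for x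
    proof -
      have "\<bar>sin (2 * pi * x)\<bar> \<le> 2 * pi * x"
        using abs_sin_x_le_abs_x[of "2 * pi * x"] that by simp
      then have "\<bar>sin (2 * pi * x) / (2 * pi)\<bar> \<le> x" by (simp add: field_simps)
      moreover have "\<bar>x * cos (2 * pi * x)\<bar> \<le> x * 1"
        unfolding abs_mult using that by (intro mult_mono) auto
      moreover have "?F x - ?F 0 = sin (2 * pi * x) / (2 * pi) - x * cos (2 * pi * x)" by simp
      ultimately show ?thesis by linarith
    qed
    show "(L * norm \<xi>)\<^sup>2 \<le> (\<integral>x. x\<^sup>2 \<partial>marginal \<xi>)" by (simp add: integral_marginal_square)
    show "0 \<le> 2 * pi + (2 * pi)\<^sup>2 * R" using nu.R_pos by simp
  qed (use scale_pos in auto)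
  finally show ?thesis by simp
qed

end

text \<open>Testing the moment identity on one unit vector determines L^2, and L is positive. This
  makes the definite description in \<open>isotropic_constant\<close> well defined.\<close>

lemma isotropic_with_constant_unique:
  fixes G :: "'a::euclidean_space set"
  assumes "isotropic_with_constant G L" "isotropic_with_constant G L'"
  shows "L = L'"
proof -
  obtain b :: 'a where "b \<in> Basis" using nonempty_Basis by blast
  then have "norm b = 1" by simp
  moreover have "L\<^sup>2 * (norm b)\<^sup>2 = L'\<^sup>2 * (norm b)\<^sup>2" "0 < L" "0 < L'"
    using assms unfolding isotropic_with_constant_def by metis+
  ultimately show ?thesis by (auto intro: power2_eq_imp_eq)
qed

lemma isotropic_with_constant_isotropic_constant:
  assumes "isotropic_position G"
  shows "isotropic_with_constant G (isotropic_constant G)"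
  using assms isotropic_with_constant_unique unfolding isotropic_position_def isotropic_constant_def
  by (metis the_equality)

text \<open>The pairing of \<xi> with the gradient is the Frechet derivative at \<xi> evaluated at
  \<xi>, so the third claim includes differentiability. The constants obtained are 1 / pi, 2 pi and
  2, all below 150.\<close>

theorem theorem2p3:
  fixes G :: "'a::euclidean_space set" and \<xi> :: 'a
  assumes "convex_symmetric_body G"
    and "isotropic_position G"
    and "\<xi> \<noteq> 0"
  shows "norm (mG G \<xi>) \<le> 150 / (isotropic_constant G * norm \<xi>)
     \<and> norm (mG G \<xi> - 1) \<le> 150 * isotropic_constant G * norm \<xi>
     \<and> (\<exists>D. (mG G has_derivative D) (at \<xi>) \<and> norm (D \<xi>) \<le> 150)"
proof -
  interpret isotropic_body G "isotropic_constant G" \<xi>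
    using isotropic_with_constant_isotropic_constant[OF assms(2)] assms
    by unfold_locales (auto simp: isotropic_with_constant_def)
  let ?l = "isotropic_constant G * norm \<xi>"
  have "1 / (pi * ?l) = (1 / pi) / ?l" by simp
  also have "\<dots> \<le> 150 / ?l"
    using scale_pos pi_gt3 by (intro divide_right_mono) (auto simp: field_simps)
  finally have "norm (mG G \<xi>) \<le> 150 / ?l" using norm_mG_le by linarith
  moreover have "2 * pi * ?l \<le> 150 * ?l"
    using scale_pos pi_less_4 by (intro mult_right_mono) auto
  then have "norm (mG G \<xi> - 1) \<le> 150 * isotropic_constant G * norm \<xi>"
    using norm_mG_minus_1_le by (simp add: mult.assoc)
  moreover have "norm (\<integral>x. \<i> * complex_of_real (2 * pi * (x \<bullet> \<xi>)) * iexp (2 * pi * (x \<bullet> \<xi>)) \<partial>unif) \<le> 150"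
    using norm_radial_derivative_le by linarith
  ultimately show ?thesis using mG_has_derivative[of \<xi>] by blast
qed

end
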